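(* Let $N\ge 1$ be an integer, $s\in(0,1)$, $T>0$. Let $\rho\in C(\mathbb{R}^N)$ with $\rho(x)>0$ for all $x\in\mathbb{R}^N$, and suppose that there exist $K>0$ and $\alpha\in\mathbb{R}$ with $\alpha<2s$ such that $\rho(x)\ge K(1+|x|^2)^{-\alpha/2}$ for all $x\in\mathbb{R}^N$. Let $u$ be a solution to the problem $$\rho\,\partial_t u+(-\Delta)^s u=0\ \text{ in } S_T,\qquad u=0\ \text{ in }\mathbb{R}^N\times\{0\}.$$ If $$|u(x,t)|\le C(1+|x|^2)^{\sigma/2}\quad\text{for all }(x,t)\in S_T,$$ for some $\sigma\in(0,2s-\alpha)$ and $C>0$, then $u\equiv0$ in $S_T$.
   Context: $S_T:=\mathbb{R}^N\times(0,T]$ and $\bar S_T=\mathbb{R}^N\times[0,T]$. $\mathcal{L}^s(\mathbb{R}^N)$ is the space of measurable $v:\mathbb{R}^N\to\mathbb{R}$ with $\|v\|_{\mathcal{L}^s(\mathbb{R}^N)}:=\int_{\mathbb{R}^N}\frac{|v(x)|}{1+|x|^{N+2s}}\,dx<\infty$. The fractional Laplacian is $(-\Delta)^s v(x)=C_{N,s}\,\mathrm{P.V.}\int_{\mathbb{R}^N}\frac{v(x)-v(y)}{|x-y|^{N+2s}}\,dy$, with $C_{N,s}=\left(\int_{\mathbb{R}^N}\frac{1-\cos(\xi_1)}{|\xi|^{N+2s}}d\xi\right)^{-1}>0$. A function $u$ is a solution to the equation $\rho\,\partial_t u+(-\Delta)^s u=0$ in $S_T$ if: $u\in C(S_T)$;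 for some $\gamma>0$ and each $t\in(0,T]$, $u(\cdot,t)\in\mathcal{L}^s(\mathbb{R}^N)\cap C^{2s+\gamma}(\mathbb{R}^N)$ if $s<\frac12$, or $u(\cdot,t)\in\mathcal{L}^s(\mathbb{R}^N)\cap C^{1,2s+\gamma-1}_{loc}(\mathbb{R}^N)$ if $s\ge\frac12$; $\partial_t u\in C(S_T)$; and $\rho(x)\partial_t u(x,t)+C_{N,s}\,\mathrm{P.V.}\int_{\mathbb{R}^N}\frac{u(x,t)-u(y,t)}{|x-y|^{N+2s}}dy=0$ for all $(x,t)\in S_T$. A function $u$ is a solution to the problem (with zero initial datum) if $u\in C(\bar S_T)$, $\partial_t u\in L^1_{loc}(\bar S_T)$, $u\in L^1((0,T),\mathcal{L}^s(\mathbb{R}^N))$, $u$ is a solution to the equation $\rho\,\partial_t u+(-\Delta)^s u=0$ in $S_T$ (that is, $u\in C(S_T)$; for some $\gamma>0$ and each $t\in(0,T]$, $u(\cdot,t)\in\mathcal{L}^s(\mathbb{R}^N)\cap C^{2s+\gamma}(\mathbb{R}^N)$ if $s<\frac12$, or $u(\cdot,t)\in\mathcal{L}^s(\mathbb{R}^N)\cap C^{1,2s+\gamma-1}_{loc}(\mathbb{R}^N)$ if $s\ge\frac12$; $\partial_t u\in C(S_T)$; and $\rho(x)\partial_t u(x,t)+C_{N,s}\,\mathrm{P.V.}\int_{\mathbb{R}^N}\frac{u(x,t)-u(y,t)}{|x-y|^{N+2s}}dy=0$ for all $(x,t)\in S_T$), and $u(x,0)=0$ for all $x\in\mathbb{R}^N$.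 *)

theory Defs
  imports "HOL-Analysis.Analysis"
begin

text \<open>
  A point of the space-time \<open>\<real>\<^sup>N \<times> \<real>\<close> is a pair \<open>(x, t)\<close> of type \<open>real^'n \<times> real\<close>, with
  \<open>N = CARD('n)\<close>.
\<close>

definition S_cyl :: "real \<Rightarrow> ((real^'n) \<times> real) set"
  where "S_cyl T = UNIV \<times> {0<..T}"

definition S_bar :: "real \<Rightarrow> ((real^'n) \<times> real) set"
  where "S_bar T = UNIV \<times> {0..T}"


definition Ls_norm :: "real \<Rightarrow> (real^'n \<Rightarrow> real) \<Rightarrow> real"
  where "Ls_norm s v =
    (\<integral>x. \<bar>v x\<bar> / (1 + norm x powr (real CARD('n) + 2 * s)) \<partial>lebesgue)"

definition Ls_space :: "real \<Rightarrow> (real^'n \<Rightarrow> real) set"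
  where "Ls_space s = {v. v \<in> borel_measurable lebesgue \<and>
    integrable lebesgue (\<lambda>x. \<bar>v x\<bar> / (1 + norm x powr (real CARD('n) + 2 * s)))}"

text \<open>
  Membership in \<open>L\<^sup>1((0,T), \<L>\<^sup>s(\<real>\<^sup>N))\<close>. As \<open>\<L>\<^sup>s\<close> is separable, strong measurability of
  \<open>t \<mapsto> u(\<cdot>,t)\<close> is expressed by joint measurability of \<open>u\<close>.
\<close>
definition L1_time_Ls :: "real \<Rightarrow> real \<Rightarrow> ((real^'n) \<times> real \<Rightarrow> real) \<Rightarrow> bool"
  where "L1_time_Ls s T u \<longleftrightarrow>
    set_borel_measurable lebesgue (UNIV \<times> {0<..<T}) u \<and>
    (AE t in lebesgue. t \<in> {0<..<T} \<longrightarrow> (\<lambda>x. u (x, t)) \<in> Ls_space s) \<and>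
    set_integrable lebesgue {0<..<T} (\<lambda>t. Ls_norm s (\<lambda>x. u (x, t)))"


text \<open>
  The reciprocal of the constant \<open>C\<^bsub>N,s\<^esub>\<close>, with the coordinate \<open>\<xi>\<^sub>1\<close> in its integrand replaced by
  \<open>\<xi>\<^sub>i\<close>. The index type carries no order, so there is no distinguished first coordinate; the
  value does not depend on \<open>i\<close> (lemma \<open>frac_const_integral_indep\<close> below).
\<close>
definition frac_const_integral :: "'n::finite \<Rightarrow> real \<Rightarrow> real"
  where "frac_const_integral i s =
    integral\<^sup>L lborel (\<lambda>\<xi>::real^'n. (1 - cos (\<xi> $ i)) / norm \<xi> powr (real CARD('n) + 2 * s))"

lemma lborel_swap_coordinates:
  fixes i j :: "'n::finite"
  defines "f \<equiv> (\<lambda>x::real^'n. \<chi> k. x $ Transposition.transpose i j k)"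
  shows "f \<in> borel_measurable borel" and "distr lborel borel f = lborel"
proof -
  let ?p = "Transposition.transpose i j"
  show f: "f \<in> borel_measurable borel"
    unfolding f_def by (intro borel_measurable_continuous_onI continuous_intros)
  have "lborel = distr lborel borel f"
  proof (rule lborel_eqI)
    fix l u :: "real^'n" assume lu: "\<And>b. b \<in> Basis \<Longrightarrow> l \<bullet> b \<le> u \<bullet> b"
    have lc: "l $ k \<le> u $ k" for k
      using lu[of "axis k 1"] by (auto simp: inner_axis Basis_vec_def)
    have lu': "f l \<bullet> b \<le> f u \<bullet> b" if "b \<in> Basis" for b
      using lc that by (auto simp: Basis_vec_def f_def inner_axis)
    have pf: "f (f x) = x" for x by (simp add: f_def vec_eq_iff)
    have mem: "f x \<in> box l u \<longleftrightarrow> x \<in> box (f l) (f u)" for x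
      unfolding f_def mem_box_cart by (simp) (metis transpose_involutory)
    have "emeasure (distr lborel borel f) (box l u) = emeasure lborel (f -` box l u)"
      using f by (subst emeasure_distr) auto
    also have "f -` box l u = box (f l) (f u)" using mem by auto
    also have "emeasure lborel \<dots> = ennreal (\<Prod>b\<in>Basis. (f u - f l) \<bullet> b)"
      using lu' by (rule emeasure_lborel_box)
    also have "(\<Prod>b\<in>Basis. (f u - f l) \<bullet> b) = (\<Prod>k\<in>UNIV. (u - l) $ ?p k)"
      by (subst prod.reindex_bij_betw[of "\<lambda>k. axis k 1" UNIV, symmetric])
         (auto simp: bij_betw_def inj_on_def axis_eq_axis Basis_vec_def inner_axis f_def)
    also have "\<dots> = (\<Prod>k\<in>UNIV. (u - l) $ k)"
      by (rule prod.reindex_bij_betw) simp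
    also have "\<dots> = (\<Prod>b\<in>Basis. (u - l) \<bullet> b)"
      by (subst prod.reindex_bij_betw[of "\<lambda>k. axis k 1" UNIV, symmetric])
         (auto simp: bij_betw_def inj_on_def axis_eq_axis Basis_vec_def inner_axis)
    finally show "emeasure (distr lborel borel f) (box l u) = (\<Prod>b\<in>Basis. (u - l) \<bullet> b)" .
  qed simp
  then show "distr lborel borel f = lborel" ..
qed

lemma frac_const_integral_indep:
  fixes i j :: "'a::finite"
  shows "frac_const_integral i s = frac_const_integral j s"
proof -
  define f where "f = (\<lambda>x::real^'a. \<chi> k. x $ Transposition.transpose i j k)"
  note sw = lborel_swap_coordinates[of i j, folded f_def]
  have nf: "norm (f x) = norm x" for x
  proof -
    have "(\<Sum>k\<in>UNIV. (x $ Transposition.transpose i j k)\<^sup>2) = (\<Sum>k\<in>UNIV. (x $ k)\<^sup>2)"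
      by (rule sum.reindex_bij_betw) simp
    then show ?thesis by (simp add: norm_vec_def L2_set_def f_def)
  qed
  have "frac_const_integral i s =
    (\<integral>\<xi>. (1 - cos (\<xi> $ i)) / norm \<xi> powr (real CARD('a) + 2 * s) \<partial>distr lborel borel f)"
    using sw by (simp add: frac_const_integral_def)
  also have "\<dots> = (\<integral>\<xi>. (1 - cos (f \<xi> $ i)) / norm (f \<xi>) powr (real CARD('a) + 2 * s) \<partial>lborel)"
    using sw(1) by (intro integral_distr) (auto intro!: borel_measurable_divide
        borel_measurable_diff borel_measurable_continuous_onI continuous_intros)
  also have "\<dots> = frac_const_integral j s"
    by (simp add: frac_const_integral_def nf) (simp add: f_def)
  finally show ?thesis .
qed

definition frac_const :: "'n::finite itself \<Rightarrow> real \<Rightarrow> real"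
  where "frac_const _ s = inverse (frac_const_integral (SOME i::'n. True) s)"


definition has_pv_integral :: "(real^'n \<Rightarrow> real) \<Rightarrow> real^'n \<Rightarrow> real \<Rightarrow> bool"
  where "has_pv_integral f x I \<longleftrightarrow>
    (\<forall>\<epsilon>>0. set_integrable lebesgue {y. \<epsilon> < dist x y} f) \<and>
    ((\<lambda>\<epsilon>. LINT y:{y. \<epsilon> < dist x y}|lebesgue. f y) \<longlongrightarrow> I) (at_right 0)"

text \<open>\<open>has_frac_laplacian s v x L\<close>: the principal value exists and \<open>(-\<Delta>)\<^sup>s v(x) = L\<close>.\<close>
definition has_frac_laplacian :: "real \<Rightarrow> (real^'n \<Rightarrow> real) \<Rightarrow> real^'n \<Rightarrow> real \<Rightarrow> bool"
  where "has_frac_laplacian s v x L \<longleftrightarrow>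
    (\<exists>I. has_pv_integral (\<lambda>y. (v x - v y) / norm (x - y) powr (real CARD('n) + 2 * s)) x I \<and>
         L = frac_const TYPE('n) s * I)"


definition holder_on :: "real \<Rightarrow> 'a::metric_space set \<Rightarrow> ('a \<Rightarrow> 'b::metric_space) \<Rightarrow> bool"
  where "holder_on \<beta> A f \<longleftrightarrow> 0 < \<beta> \<and> \<beta> \<le> 1 \<and>
    (\<exists>H\<ge>0. \<forall>x\<in>A. \<forall>y\<in>A. dist (f x) (f y) \<le> H * dist x y powr \<beta>)"

definition C1_holder_loc :: "real \<Rightarrow> (real^'n \<Rightarrow> real) \<Rightarrow> bool"
  where "C1_holder_loc \<beta> v \<longleftrightarrow>
    (\<exists>g. (\<forall>x. GDERIV v x :> g x) \<and> (\<forall>A. compact A \<longrightarrow> holder_on \<beta> A g))"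

text \<open>
  \<open>C\<^bsup>2s+\<gamma>\<^esup>(\<real>\<^sup>N)\<close> is the class of (not necessarily bounded) functions satisfying a Hoelder
  condition with exponent \<open>2s+\<gamma> \<le> 1\<close> on the whole of \<open>\<real>\<^sup>N\<close>. Since \<open>\<gamma>\<close> is quantified existentially
  in the definition of a solution, the bounds \<open>2s+\<gamma> \<le> 1\<close> and \<open>2s+\<gamma>-1 \<le> 1\<close> only say that \<open>\<gamma>\<close> is
  taken small.
\<close>
definition frac_regular :: "real \<Rightarrow> real \<Rightarrow> (real^'n \<Rightarrow> real) \<Rightarrow> bool"
  where "frac_regular s \<gamma> v \<longleftrightarrow>
    (if s < 1/2 then holder_on (2 * s + \<gamma>) UNIV v else C1_holder_loc (2 * s + \<gamma> - 1) v)"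


text \<open>
  The derivative is taken within \<open>(0,T]\<close>, hence is one-sided at \<open>t = T\<close>. The value at \<open>t = 0\<close> is
  irrelevant: it is only used below under an integral, on a null set.
\<close>
definition time_deriv :: "real \<Rightarrow> ((real^'n) \<times> real \<Rightarrow> real) \<Rightarrow> (real^'n) \<times> real \<Rightarrow> real"
  where "time_deriv T u = (\<lambda>(x, t). vector_derivative (\<lambda>\<tau>. u (x, \<tau>)) (at t within {0<..T}))"

definition equation_solution ::
    "(real^'n \<Rightarrow> real) \<Rightarrow> real \<Rightarrow> real \<Rightarrow> ((real^'n) \<times> real \<Rightarrow> real) \<Rightarrow> bool"
  where "equation_solution \<rho> s T u \<longleftrightarrow>
    continuous_on (S_cyl T) u \<and>
    (\<exists>\<gamma>>0. \<forall>t\<in>{0<..T}. (\<lambda>x. u (x, t)) \<in> Ls_space s \<and> frac_regular s \<gamma> (\<lambda>x. u (x, t))) \<and>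
    (\<forall>(x, t)\<in>S_cyl T. (\<lambda>\<tau>. u (x, \<tau>)) differentiable (at t within {0<..T})) \<and>
    continuous_on (S_cyl T) (time_deriv T u) \<and>
    (\<forall>(x, t)\<in>S_cyl T. \<exists>L. has_frac_laplacian s (\<lambda>y. u (y, t)) x L \<and>
       \<rho> x * time_deriv T u (x, t) + L = 0)"

definition zero_problem_solution ::
    "(real^'n \<Rightarrow> real) \<Rightarrow> real \<Rightarrow> real \<Rightarrow> ((real^'n) \<times> real \<Rightarrow> real) \<Rightarrow> bool"
  where "zero_problem_solution \<rho> s T u \<longleftrightarrow>
    continuous_on (S_bar T) u \<and>
    (\<forall>A. compact A \<and> A \<subseteq> S_bar T \<longrightarrow> time_deriv T u absolutely_integrable_on A) \<and>
    L1_time_Ls s T u \<and>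
    equation_solution \<rho> s T u \<and>
    (\<forall>x. u (x, 0) = 0)"

end

theory Submission
  imports Defs
begin

text \<open>
  A lower bound on the weight \<open>\<rho>\<close> limits the speed of diffusion, and this turns the growth
  condition into decay. Fix a point \<open>z\<close> with \<open>R = |z| \<ge> 1\<close> and put \<open>r = R/4\<close>. On the ball of
  radius \<open>2r\<close> about \<open>z\<close> the function \<open>u\<close> is at most some \<open>U\<close> of order \<open>R powr \<sigma>\<close>, and on the ball of
  radius \<open>r\<close> the weight is at least of order \<open>R powr -\<alpha>\<close>. The paraboloid \<open>U |x - z|\<^sup>2 / r\<^sup>2 + B(t)\<close>
  lies above \<open>u\<close> on the boundary of the smaller ball and at the initial time; it is a supersolution
  as soon as \<open>\<rho> B'\<close> dominates the fractional Laplacian of the quadratic part, of order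
  \<open>R powr (\<sigma> - 2s)\<close>, plus the contribution \<open>m(t)\<close> of the values of \<open>u\<close> at distance at least \<open>r\<close>
  from \<open>x\<close>. At \<open>x = z\<close> only \<open>B\<close> is left. Thus \<open>u(z,t)\<close> is at most a constant times
  \<open>R powr (\<sigma> - 2s + \<alpha>)\<close>, where the exponent is negative, plus a constant times \<open>R powr \<alpha>\<close> times the
  integral of \<open>m\<close> over \<open>[0,t]\<close> (\<open>comparison_in_ball\<close>, \<open>interior_estimate\<close>).

  The term \<open>m\<close> is estimated in two ways. If \<open>\<alpha> \<ge> 0\<close>, then \<open>\<sigma> < 2s\<close>, and the pointwise growth bound
  gives \<open>m\<close> of order \<open>R powr (\<sigma> - 2s)\<close> (\<open>decay_of_subcritical_growth\<close>). If \<open>\<alpha> < 0\<close>, then \<open>m(t)\<close> is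
  at most a constant times the \<open>\<L>\<^sup>s\<close> norm of \<open>u(\<cdot>,t)\<close>, which is integrable in time, and the factor
  \<open>R powr \<alpha>\<close> supplies the decay (\<open>decay_of_integrable_solution\<close>). That norm need not be continuous
  in \<open>t\<close>, but by Fatou's lemma it is lower semicontinuous. This is all that the comparison needs,
  because it uses only difference quotients from the left.

  Hence the positive part of \<open>u\<close> tends to zero at infinity, uniformly in time, and the maximum
  principle applied to \<open>u - \<epsilon> t\<close> gives \<open>u \<le> 0\<close> (\<open>maximum_principle_decaying\<close>). The same holds
  for \<open>-u\<close>.
\<close>

section \<open>Integrals of radial powers\<close>

text \<open>
  On the shell \<open>R k / 2 \<le> |x - y| \<le> R k\<close> the kernel is at most \<open>2 powr |e|\<close> times \<open>R k powr e\<close>, and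
  the volume of the shell is at most that of the ball of radius \<open>R k\<close>. A cover by such shells
  therefore reduces the integral to a series, which is geometric for dyadic radii. No shell contains
  \<open>x\<close> itself, where the kernel has the value \<open>0 powr e = 0\<close>.
\<close>
lemma power_kernel_integral:
  fixes x :: "'a::euclidean_space" and e :: real and R :: "nat \<Rightarrow> real"
  assumes A: "A \<in> sets borel"
    and cover: "A \<subseteq> insert x (\<Union>k. {y. R k / 2 \<le> dist x y \<and> dist x y \<le> R k})"
    and R: "\<And>k. 0 < R k"
    and sm: "summable (\<lambda>k. R k powr (e + real DIM('a)))"
  shows "set_integrable lebesgue A (\<lambda>y. dist x y powr e)" (is ?int)
    and "(LINT y:A|lebesgue. dist x y powr e)
      \<le> 2 powr \<bar>e\<bar> * unit_ball_vol (real DIM('a)) * (\<Sum>k. R k powr (e + real DIM('a)))" (is ?le)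
proof -
  define c where "c = 2 powr \<bar>e\<bar> * unit_ball_vol (real DIM('a))"
  define f where "f = (\<lambda>y. indicator A y *\<^sub>R dist x y powr e :: real)"
  define S where "S = (\<lambda>k. {y. R k / 2 \<le> dist x y \<and> dist x y \<le> R k})"
  have c0: "0 \<le> c" by (simp add: c_def)
  have [measurable]: "S k \<in> sets borel" for k
    unfolding S_def by measurable
  have [measurable]: "f \<in> borel_measurable borel"
    unfolding f_def using A by measurable
  have shell: "(\<integral>\<^sup>+ y. indicator (S k) y * ennreal (dist x y powr e) \<partial>lborel)
      \<le> ennreal (c * R k powr (e + real DIM('a)))" for k
  proof -
    have le: "dist x y powr e \<le> 2 powr \<bar>e\<bar> * R k powr e" if "y \<in> S k" for y
    proof -
      have d: "R k / 2 \<le> dist x y" "dist x y \<le> R k" using that by (auto simp: S_def)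
      have d0: "0 < dist x y" using d R[of k] by linarith
      show ?thesis
      proof (cases "0 \<le> e")
        case True
        have "dist x y powr e \<le> 1 * R k powr e" using True d by (simp add: powr_mono2)
        also have "\<dots> \<le> 2 powr \<bar>e\<bar> * R k powr e"
          by (intro mult_right_mono) (auto intro: ge_one_powr_ge_zero)
        finally show ?thesis .
      next
        case False
        have "dist x y powr e \<le> (R k / 2) powr e"
          using False d R[of k] by (intro powr_mono2') auto
        also have "\<dots> = 2 powr \<bar>e\<bar> * R k powr e"
          using False R[of k] by (simp add: powr_divide powr_minus field_simps)
        finally show ?thesis .
      qed
    qed
    have "(\<integral>\<^sup>+ y. indicator (S k) y * ennreal (dist x y powr e) \<partial>lborel)
        \<le> (\<integral>\<^sup>+ y. ennreal (2 powr \<bar>e\<bar> * R k powr e) * indicator (cball x (R k)) y \<partial>lborel)"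
      using le by (intro nn_integral_mono)
        (auto simp: indicator_def S_def intro!: ennreal_leI)
    also have "\<dots> = ennreal (2 powr \<bar>e\<bar> * R k powr e) * emeasure lborel (cball x (R k))"
      by (simp add: nn_integral_cmult_indicator)
    also have "\<dots> = ennreal (2 powr \<bar>e\<bar> * R k powr e * (unit_ball_vol (real DIM('a)) * R k ^ DIM('a)))"
      using R[of k] by (simp add: emeasure_cball ennreal_mult'')
    also have "2 powr \<bar>e\<bar> * R k powr e * (unit_ball_vol (real DIM('a)) * R k ^ DIM('a))
        = c * R k powr (e + real DIM('a))"
      using R[of k] by (simp add: c_def powr_add powr_realpow)
    finally show ?thesis .
  qed
  have "(\<integral>\<^sup>+ y. ennreal (f y) \<partial>lborel)
      \<le> (\<integral>\<^sup>+ y. (\<Sum>k. indicator (S k) y * ennreal (dist x y powr e)) \<partial>lborel)"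
  proof (rule nn_integral_mono)
    fix y
    show "ennreal (f y) \<le> (\<Sum>k. indicator (S k) y * ennreal (dist x y powr e))"
    proof (cases "y \<in> A \<and> y \<noteq> x")
      case True
      then obtain k where k: "y \<in> S k" using cover by (auto simp: S_def)
      have "(\<Sum>j\<in>{k}. indicator (S j) y * ennreal (dist x y powr e))
          \<le> (\<Sum>k. indicator (S k) y * ennreal (dist x y powr e))"
        by (rule sum_le_suminf) auto
      then show ?thesis using True k by (simp add: f_def)
    next
      case False
      then have "f y = 0" by (auto simp: f_def)
      then show ?thesis by simp
    qed
  qed
  also have "\<dots> = (\<Sum>k. \<integral>\<^sup>+ y. indicator (S k) y * ennreal (dist x y powr e) \<partial>lborel)"
    by (rule nn_integral_suminf) measurable
  also have "\<dots> \<le> (\<Sum>k. ennreal (c * R k powr (e + real DIM('a))))"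
    by (intro suminf_le shell) auto
  also have "\<dots> = ennreal (c * (\<Sum>k. R k powr (e + real DIM('a))))"
    using sm c0 by (subst suminf_ennreal2) (auto simp: suminf_mult intro!: summable_mult)
  finally have fin: "(\<integral>\<^sup>+ y. ennreal (f y) \<partial>lborel) \<le> ennreal (c * (\<Sum>k. R k powr (e + real DIM('a))))" .
  have f0: "0 \<le> f y" for y by (simp add: f_def)
  have "integrable lborel f"
    using fin f0 by (intro integrableI_nonneg) (auto simp: top_unique order_le_less_trans)
  then show ?int
    unfolding set_integrable_def f_def[symmetric] by (simp add: integrable_completion)
  have s0: "0 \<le> (\<Sum>k. R k powr (e + real DIM('a)))" using sm by (intro suminf_nonneg) auto
  have "integral\<^sup>L lborel f \<le> c * (\<Sum>k. R k powr (e + real DIM('a)))"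
    using fin f0 c0 s0 by (intro integral_real_bounded) auto
  then show ?le
    unfolding set_lebesgue_integral_def f_def[symmetric] c_def by (simp add: integral_completion)
qed

lemma dyadic_scale:
  fixes r d :: real
  assumes "1 \<le> d / r" "0 < r"
  obtains k :: nat where "r * 2 ^ k \<le> d" "d \<le> r * 2 ^ Suc k"
proof -
  define q where "q = d / r"
  have q: "1 \<le> q" using assms by (simp add: q_def)
  obtain n where n: "q < 2 ^ n" using real_arch_pow[of 2 q] by auto
  define k where "k = (LEAST n. q < 2 ^ n)"
  have k: "q < 2 ^ k" unfolding k_def using n by (rule LeastI)
  have "k \<noteq> 0" using k q by (intro notI) simp
  then obtain j where j: "k = Suc j" by (metis not0_implies_Suc)
  have "\<not> q < 2 ^ j" using not_less_Least[of j "\<lambda>n. q < 2 ^ n"] j k_def by simp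
  then have "r * 2 ^ j \<le> d" "d \<le> r * 2 ^ Suc j"
    using k assms j by (auto simp: q_def field_simps)
  then show thesis using that by blast
qed

lemma power_kernel_inside:
  fixes e :: real
  assumes "- real DIM('a::euclidean_space) < e"
  obtains k where "0 \<le> k"
    and "\<And>(x::'a) r. 0 < r \<Longrightarrow> set_integrable lebesgue (ball x r) (\<lambda>y. dist x y powr e)"
    and "\<And>(x::'a) r. 0 < r \<Longrightarrow>
      (LINT y:ball x r|lebesgue. dist x y powr e) \<le> k * r powr (e + real DIM('a))"
proof -
  define p where "p = e + real DIM('a)"
  have p: "0 < p" using assms by (simp add: p_def)
  define q where "q = 2 powr (- p)"
  have q: "0 < q" "q < 1" using p powr_less_mono[of "- p" 0 2] by (auto simp: q_def)
  have eq: "(r / 2 ^ k) powr p = r powr p * q ^ k" if "0 < r" for r k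
  proof -
    have "q ^ k = (2 ^ k) powr (- p)"
      by (simp add: q_def powr_powr powr_realpow[symmetric] mult.commute)
    then show ?thesis using that by (simp add: powr_divide powr_minus_divide)
  qed
  define k where "k = 2 powr \<bar>e\<bar> * unit_ball_vol (real DIM('a)) * (1 / (1 - q))"
  have cover: "ball x r \<subseteq> insert x (\<Union>k. {y. r / 2 ^ k / 2 \<le> dist x y \<and> dist x y \<le> r / 2 ^ k})"
    if r: "0 < r" for x :: 'a and r
  proof
    fix y assume y: "y \<in> ball x r"
    show "y \<in> insert x (\<Union>k. {y. r / 2 ^ k / 2 \<le> dist x y \<and> dist x y \<le> r / 2 ^ k})"
    proof (cases "y = x")
      case False
      then have d: "0 < dist x y" "dist x y < r" using y by (auto simp: dist_commute)
      then obtain n where n: "dist x y * 2 ^ n \<le> r" "r \<le> dist x y * 2 ^ Suc n"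
        using dyadic_scale[of r "dist x y"] by (auto simp: field_simps)
      then have "r / 2 ^ n / 2 \<le> dist x y \<and> dist x y \<le> r / 2 ^ n"
        by (simp add: field_simps)
      then show ?thesis by blast
    qed simp
  qed
  have sm: "summable (\<lambda>k. (r / 2 ^ k) powr p)" if "0 < r" for r
    using q that by (simp add: eq summable_mult summable_geometric)
  have su: "(\<Sum>k. (r / 2 ^ k) powr p) = r powr p * (1 / (1 - q))" if "0 < r" for r
    using q that by (simp add: eq suminf_mult summable_geometric suminf_geometric)
  show thesis
  proof (rule that[of k])
    show "0 \<le> k" using q by (simp add: k_def)
    fix x :: 'a and r :: real assume r: "0 < r"
    note * = power_kernel_integral[OF _ cover[OF r], where e = e]
    show "set_integrable lebesgue (ball x r) (\<lambda>y. dist x y powr e)"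
      using r sm[OF r] by (intro *(1)) (auto simp: p_def)
    have "(LINT y:ball x r|lebesgue. dist x y powr e)
        \<le> 2 powr \<bar>e\<bar> * unit_ball_vol (real DIM('a)) * (\<Sum>k. (r / 2 ^ k) powr (e + real DIM('a)))"
      using r sm[OF r] by (intro *(2)) (auto simp: p_def)
    also have "\<dots> = k * r powr (e + real DIM('a))"
      using su[OF r] by (simp add: p_def k_def)
    finally show "(LINT y:ball x r|lebesgue. dist x y powr e) \<le> k * r powr (e + real DIM('a))" .
  qed
qed

lemma power_kernel_outside:
  fixes e :: real
  assumes "e < - real DIM('a::euclidean_space)"
  obtains k where "0 \<le> k"
    and "\<And>(x::'a) r. 0 < r \<Longrightarrow> set_integrable lebesgue {y. r \<le> dist x y} (\<lambda>y. dist x y powr e)"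
    and "\<And>(x::'a) r. 0 < r \<Longrightarrow>
      (LINT y:{y. r \<le> dist x y}|lebesgue. dist x y powr e) \<le> k * r powr (e + real DIM('a))"
proof -
  define p where "p = e + real DIM('a)"
  have p: "p < 0" using assms by (simp add: p_def)
  define q where "q = 2 powr p"
  have q: "0 < q" "q < 1" using p powr_less_mono[of p 0 2] by (auto simp: q_def)
  have eq: "(r * 2 ^ Suc k) powr p = r powr p * q * q ^ k" if "0 < r" for r k
  proof -
    have "q ^ Suc k = (2 ^ Suc k) powr p"
      by (simp only: q_def powr_powr powr_realpow[symmetric] mult.commute zero_less_numeral)
        (simp add: powr_powr powr_realpow[symmetric] algebra_simps flip: powr_add)
    then show ?thesis using that by (simp add: powr_mult mult.assoc)
  qed
  define k where "k = 2 powr \<bar>e\<bar> * unit_ball_vol (real DIM('a)) * (q / (1 - q))"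
  have cover: "{y. r \<le> dist x y}
      \<subseteq> insert x (\<Union>k. {y. r * 2 ^ Suc k / 2 \<le> dist x y \<and> dist x y \<le> r * 2 ^ Suc k})"
    if r: "0 < r" for x :: 'a and r
  proof
    fix y assume "y \<in> {y. r \<le> dist x y}"
    then obtain n where "r * 2 ^ n \<le> dist x y" "dist x y \<le> r * 2 ^ Suc n"
      using dyadic_scale[of "dist x y" r] r by (auto simp: field_simps)
    then have "r * 2 ^ Suc n / 2 \<le> dist x y \<and> dist x y \<le> r * 2 ^ Suc n" by simp
    then show "y \<in> insert x (\<Union>k. {y. r * 2 ^ Suc k / 2 \<le> dist x y \<and> dist x y \<le> r * 2 ^ Suc k})"
      by blast
  qed
  have sm: "summable (\<lambda>k. (r * 2 ^ Suc k) powr p)" if "0 < r" for r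
    unfolding eq[OF that] using q by (intro summable_mult summable_geometric) auto
  have su: "(\<Sum>k. (r * 2 ^ Suc k) powr p) = r powr p * (q / (1 - q))" if "0 < r" for r
    unfolding eq[OF that] using q by (subst suminf_mult) (auto simp: suminf_geometric summable_geometric)
  show thesis
  proof (rule that[of k])
    show "0 \<le> k" using q by (simp add: k_def)
    fix x :: 'a and r :: real assume r: "0 < r"
    have A: "{y. r \<le> dist x y} \<in> sets borel" by measurable
    note * = power_kernel_integral[OF A cover[OF r], where e = e]
    show "set_integrable lebesgue {y. r \<le> dist x y} (\<lambda>y. dist x y powr e)"
      using r sm[OF r] by (intro *(1)) (auto simp: p_def)
    have "(LINT y:{y. r \<le> dist x y}|lebesgue. dist x y powr e)
        \<le> 2 powr \<bar>e\<bar> * unit_ball_vol (real DIM('a)) * (\<Sum>k. (r * 2 ^ Suc k) powr (e + real DIM('a)))"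
      using r sm[OF r] by (intro *(2)) (auto simp: p_def)
    also have "\<dots> = k * r powr (e + real DIM('a))"
      using su[OF r] by (simp add: p_def k_def)
    finally show "(LINT y:{y. r \<le> dist x y}|lebesgue. dist x y powr e) \<le> k * r powr (e + real DIM('a))" .
  qed
qed

section \<open>The principal value and the time derivative at a touching point\<close>

text \<open>Oddness is meant with respect to the point reflection at \<open>x\<close>. No integrability is assumed.\<close>
lemma lebesgue_integral_odd:
  fixes h :: "'a::euclidean_space \<Rightarrow> real"
  assumes h: "h \<in> borel_measurable borel" and odd: "\<And>y. h (2 *\<^sub>R x - y) = - h y"
  shows "integral\<^sup>L lebesgue h = 0"
proof -
  have m: "(\<lambda>y. 2 *\<^sub>R x + (-1) *\<^sub>R y) \<in> borel_measurable (borel :: 'a measure)"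
    by measurable
  have "lborel = distr lborel borel (\<lambda>y. 2 *\<^sub>R x + (-1) *\<^sub>R y :: 'a)"
    using lborel_affine[of "-1" "2 *\<^sub>R x"] by (simp add: density_1)
  then have "integral\<^sup>L lborel h = integral\<^sup>L (distr lborel borel (\<lambda>y. 2 *\<^sub>R x + (-1) *\<^sub>R y)) h"
    by simp
  also have "\<dots> = (\<integral>y. h (2 *\<^sub>R x + (-1) *\<^sub>R y) \<partial>lborel)"
    using m h by (intro integral_distr) auto
  also have "\<dots> = - integral\<^sup>L lborel h" by (simp add: odd)
  finally show ?thesis using h by (simp add: integral_completion)
qed

text \<open>
  If \<open>v\<close> is touched from above at \<open>x\<close>, within distance \<open>r\<close>, by a paraboloid of opening \<open>a\<close>, then its
  principal value integral is bounded below by the quadratic part of the paraboloid and by the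
  values of \<open>v\<close> outside the ball. The linear part is odd about \<open>x\<close> and integrates to zero over every
  annulus, so the gradient \<open>b\<close> does not enter the bound.
\<close>
lemma pv_integral_lower_bound:
  fixes v :: "real^'n \<Rightarrow> real" and x b :: "real^'n" and a r p I Q M :: real
  assumes pv: "has_pv_integral (\<lambda>y. (v x - v y) / norm (x - y) powr p) x I"
    and r: "0 < r" and a: "0 \<le> a"
    and touch: "\<And>y. y \<in> ball x r \<Longrightarrow> - (b \<bullet> (y - x)) - a * (dist x y)\<^sup>2 \<le> v x - v y"
    and quad: "set_integrable lebesgue (ball x r) (\<lambda>y. dist x y powr (2 - p))"
      "(LINT y:ball x r|lebesgue. dist x y powr (2 - p)) \<le> Q"
    and G: "set_integrable lebesgue {y. r \<le> dist x y} G"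
      "(LINT y:{y. r \<le> dist x y}|lebesgue. G y) \<le> M"
      "\<And>y. r \<le> dist x y \<Longrightarrow> - G y \<le> (v x - v y) / norm (x - y) powr p"
  shows "- (a * Q + M) \<le> I"
proof -
  define f where "f = (\<lambda>y. (v x - v y) / norm (x - y) powr p)"
  have int: "set_integrable lebesgue {y. \<epsilon> < dist x y} f" if "0 < \<epsilon>" for \<epsilon>
    using pv that unfolding has_pv_integral_def f_def by blast
  have lim: "((\<lambda>\<epsilon>. LINT y:{y. \<epsilon> < dist x y}|lebesgue. f y) \<longlongrightarrow> I) (at_right 0)"
    using pv unfolding has_pv_integral_def f_def by blast
  have main: "- (a * Q + M) \<le> (LINT y:{y. \<epsilon> < dist x y}|lebesgue. f y)"
    if \<epsilon>: "0 < \<epsilon>" "\<epsilon> < r" for \<epsilon>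
  proof -
    define An where "An = {y. \<epsilon> < dist x y \<and> dist x y < r}"
    define Out where "Out = {y. r \<le> dist x y}"
    have [measurable]: "An \<in> sets borel" "Out \<in> sets borel"
      unfolding An_def Out_def by measurable
    have un: "{y. \<epsilon> < dist x y} = An \<union> Out" and dj: "An \<inter> Out = {}"
      using \<epsilon> by (auto simp: An_def Out_def)
    have fAn: "set_integrable lebesgue An f" and fOut: "set_integrable lebesgue Out f"
      using int[OF \<epsilon>(1)] un by (auto intro: set_integrable_subset)
    have out: "- M \<le> (LINT y:Out|lebesgue. f y)"
    proof -
      have "- M \<le> (LINT y:Out|lebesgue. - G y)"
        using G(1,2) by (simp add: Out_def set_integral_uminus)
      also have "\<dots> \<le> (LINT y:Out|lebesgue. f y)"
        using G fOut by (intro set_integral_mono) (auto simp: Out_def f_def set_integrable_def)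
      finally show ?thesis .
    qed
    define lin where "lin = (\<lambda>y. (b \<bullet> (y - x)) * dist x y powr (- p))"
    have [measurable]: "lin \<in> borel_measurable borel" unfolding lin_def by measurable
    have linint: "set_integrable lebesgue An lin"
    proof -
      have "set_integrable lborel An lin"
      proof (rule set_integrable_bound)
        \<comment> \<open>The sum of the two powers covers both signs of \<open>p\<close>.\<close>
        show "set_integrable lborel An (\<lambda>y. norm b * r * (\<epsilon> powr (-p) + r powr (-p)))"
        proof -
          have "emeasure lborel An \<le> emeasure lborel (ball x r)"
            by (intro emeasure_mono) (auto simp: An_def)
          also have "\<dots> < \<infinity>" using r by (simp add: emeasure_ball)
          finally show ?thesis
            unfolding set_integrable_def by (intro integrable_scaleR_left) (auto simp: integrable_indicator_iff)
        qed
        show "set_borel_measurable lborel An lin"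
          unfolding set_borel_measurable_def by measurable
        show "AE y in lborel. y \<in> An \<longrightarrow> norm (lin y) \<le> norm (norm b * r * (\<epsilon> powr (-p) + r powr (-p)))"
        proof (intro always_eventually allI impI)
          fix y assume y: "y \<in> An"
          then have d: "\<epsilon> < dist x y" "dist x y < r" by (auto simp: An_def)
          have 1: "\<bar>b \<bullet> (y - x)\<bar> \<le> norm b * r"
            using Cauchy_Schwarz_ineq2[of b "y - x"] d
            by (smt (verit) dist_norm dist_commute mult_left_mono norm_ge_zero)
          have 2: "dist x y powr (- p) \<le> \<epsilon> powr (-p) + r powr (-p)"
          proof (cases "0 \<le> p")
            case True
            then have "dist x y powr (- p) \<le> \<epsilon> powr (-p)" using d \<epsilon> by (intro powr_mono2') auto
            then show ?thesis by (simp add: add_increasing2)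
          next
            case False
            then have "dist x y powr (- p) \<le> r powr (-p)" using d \<epsilon> by (intro powr_mono2) auto
            then show ?thesis by (simp add: add_increasing)
          qed
          have "norm (lin y) = \<bar>b \<bullet> (y - x)\<bar> * dist x y powr (- p)" by (simp add: lin_def abs_mult)
          also have "\<dots> \<le> norm b * r * (\<epsilon> powr (-p) + r powr (-p))"
            using 1 2 r by (intro mult_mono) auto
          also have "\<dots> \<le> norm (norm b * r * (\<epsilon> powr (-p) + r powr (-p)))" by simp
          finally show "norm (lin y) \<le> norm (norm b * r * (\<epsilon> powr (-p) + r powr (-p)))" .
        qed
      qed
      then show ?thesis
        unfolding set_integrable_def by (subst integrable_completion) auto
    qed
    have lin0: "(LINT y:An|lebesgue. lin y) = 0"
      unfolding set_lebesgue_integral_def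
    proof (rule lebesgue_integral_odd)
      show "(\<lambda>y. indicator An y *\<^sub>R lin y) \<in> borel_measurable borel" by measurable
      fix y
      have "dist x (2 *\<^sub>R x - y) = dist x y"
        by (simp add: dist_norm scaleR_2 norm_minus_commute)
      moreover have "b \<bullet> ((2 *\<^sub>R x - y) - x) = - (b \<bullet> (y - x))"
        by (simp add: scaleR_2 inner_diff_right)
      ultimately show "indicator An (2 *\<^sub>R x - y) *\<^sub>R lin (2 *\<^sub>R x - y) = - (indicator An y *\<^sub>R lin y)"
        by (simp add: lin_def An_def indicator_def)
    qed
    have qAn: "set_integrable lebesgue An (\<lambda>y. dist x y powr (2 - p))"
      by (rule set_integrable_subset[OF quad(1)]) (auto simp: An_def)
    have "(LINT y:An|lebesgue. dist x y powr (2 - p)) \<le> (LINT y:ball x r|lebesgue. dist x y powr (2 - p))"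
      using qAn quad(1) unfolding set_lebesgue_integral_def set_integrable_def
      by (intro integral_mono) (auto simp: An_def indicator_def)
    then have qQ: "(LINT y:An|lebesgue. dist x y powr (2 - p)) \<le> Q" using quad(2) by simp
    have ilin: "set_integrable lebesgue An (\<lambda>y. - lin y)"
      using linint by (simp add: set_integrable_def)
    have iq: "set_integrable lebesgue An (\<lambda>y. a * dist x y powr (2 - p))"
      using qAn by (intro set_integrable_mult_right)
    have "- (a * Q) \<le> - (a * (LINT y:An|lebesgue. dist x y powr (2 - p)))"
      using qQ a by (simp add: mult_left_mono)
    also have "\<dots> = (LINT y:An|lebesgue. - lin y - a * dist x y powr (2 - p))"
      using ilin iq lin0 set_integral_uminus[OF linint]
      by (subst set_integral_diff(2)) auto
    also have "\<dots> \<le> (LINT y:An|lebesgue. f y)"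
    proof (rule set_integral_mono)
      show "set_integrable lebesgue An (\<lambda>y. - lin y - a * dist x y powr (2 - p))"
        using ilin iq by (rule set_integral_diff(1))
      fix y assume y: "y \<in> An"
      then have d: "0 < dist x y" "dist x y < r" using \<epsilon> by (auto simp: An_def)
      have "- lin y - a * dist x y powr (2 - p)
          = (- (b \<bullet> (y - x)) - a * (dist x y)\<^sup>2) * dist x y powr (- p)"
        using d powr_add[of "dist x y" 2 "- p"]
        by (simp add: lin_def algebra_simps flip: powr_numeral)
      also have "\<dots> \<le> (v x - v y) * dist x y powr (- p)"
        using touch[of y] d by (intro mult_right_mono) auto
      also have "\<dots> = f y" by (simp add: f_def dist_norm powr_minus divide_inverse)
      finally show "- lin y - a * dist x y powr (2 - p) \<le> f y" .
    qed (fact fAn)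
    finally have "- (a * Q) \<le> (LINT y:An|lebesgue. f y)" .
    moreover have "(LINT y:{y. \<epsilon> < dist x y}|lebesgue. f y)
        = (LINT y:An|lebesgue. f y) + (LINT y:Out|lebesgue. f y)"
      unfolding un by (rule set_integral_Un[OF dj fAn fOut])
    ultimately show ?thesis using out by linarith
  qed
  have "\<forall>\<^sub>F \<epsilon> in at_right 0. - (a * Q + M) \<le> (LINT y:{y. \<epsilon> < dist x y}|lebesgue. f y)"
    unfolding eventually_at_right_field using r main by blast
  then show ?thesis
    by (intro tendsto_lowerbound[OF lim]) auto
qed

lemma pv_integral_nonneg_at_max:
  fixes v :: "real^'n \<Rightarrow> real"
  assumes pv: "has_pv_integral (\<lambda>y. (v x - v y) / norm (x - y) powr p) x I"
    and max: "\<And>y. v y \<le> v x"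
  shows "0 \<le> I"
proof (rule tendsto_lowerbound)
  show "((\<lambda>\<epsilon>. LINT y:{y. \<epsilon> < dist x y}|lebesgue. (v x - v y) / norm (x - y) powr p) \<longlongrightarrow> I) (at_right 0)"
    using pv unfolding has_pv_integral_def by blast
  show "\<forall>\<^sub>F \<epsilon> in at_right 0. 0 \<le> (LINT y:{y. \<epsilon> < dist x y}|lebesgue. (v x - v y) / norm (x - y) powr p)"
    unfolding set_lebesgue_integral_def using max
    by (intro always_eventually allI Bochner_Integration.integral_nonneg) auto
qed simp

lemma left_difference_quotient_le_derivative:
  fixes w :: "real \<Rightarrow> real"
  assumes D: "(w has_real_derivative D) (at t within {0<..T})"
    and t: "0 < t" "t \<le> T"
    and q: "\<forall>\<^sub>F \<tau> in at_left t. (t - \<tau>) * q \<le> w t - w \<tau>"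
  shows "q \<le> D"
proof -
  have "((\<lambda>y. (w y - w t) / (y - t)) \<longlongrightarrow> D) (at t within {0<..T})"
    using D by (simp add: has_field_derivative_iff)
  then have "((\<lambda>y. (w y - w t) / (y - t)) \<longlongrightarrow> D) (at t within {0<..<t})"
    by (rule tendsto_within_subset) (use t in auto)
  moreover have "at t within {0<..<t} = at_left t"
    using t by (intro at_within_nhd[of t "{0<..}"]) auto
  ultimately have "((\<lambda>y. (w y - w t) / (y - t)) \<longlongrightarrow> D) (at_left t)" by simp
  moreover have left: "\<forall>\<^sub>F y in at_left t. y < t" by (simp add: eventually_at_filter)
  have "\<forall>\<^sub>F y in at_left t. q \<le> (w y - w t) / (y - t)"
    using q left
  proof eventually_elim
    case (elim y)
    then have "(w y - w t) / (y - t) = (w t - w y) / (t - y)"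
      by (metis minus_diff_eq minus_divide_divide)
    then show ?case using elim by (simp add: field_simps)
  qed
  ultimately show ?thesis by (intro tendsto_lowerbound) auto
qed

section \<open>Comparison arguments\<close>

text \<open>
  \<open>u\<close> satisfies \<open>\<rho> \<partial>\<^sub>t u + c PV = 0\<close> pointwise on \<open>\<real>\<^sup>N \<times> (0,T]\<close>, where \<open>PV\<close> is the principal value
  integral without its normalising constant. The time derivative is taken within \<open>(0,T]\<close>. Only the
  equation is recorded: neither regularity in \<open>x\<close> nor the initial condition is part of the notion.
\<close>
definition pv_solution ::
    "real \<Rightarrow> (real^'n \<Rightarrow> real) \<Rightarrow> real \<Rightarrow> real \<Rightarrow> ((real^'n) \<times> real \<Rightarrow> real) \<Rightarrow> bool"
  where "pv_solution c \<rho> s T u \<longleftrightarrow>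
    (\<forall>x. \<forall>t\<in>{0<..T}. \<exists>D I.
      ((\<lambda>\<tau>. u (x, \<tau>)) has_real_derivative D) (at t within {0<..T}) \<and>
      has_pv_integral (\<lambda>y. (u (x, t) - u (y, t)) / norm (x - y) powr (real CARD('n) + 2 * s)) x I \<and>
      \<rho> x * D + c * I = 0)"

text \<open>
  For all centres \<open>x\<close> within distance \<open>r\<close> of \<open>z\<close>, the part of \<open>u(\<cdot>,t)\<close> at distance at least \<open>r\<close> from
  \<open>x\<close> contributes at most \<open>m t\<close> to the nonlocal operator. The bound passes through an integrable
  majorant \<open>G\<close>, which may depend on \<open>x\<close> and \<open>t\<close>.
\<close>
definition far_field_bound ::
    "real \<Rightarrow> real \<Rightarrow> ((real^'n) \<times> real \<Rightarrow> real) \<Rightarrow> real^'n \<Rightarrow> real \<Rightarrow> (real \<Rightarrow> real) \<Rightarrow> bool"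
  where "far_field_bound s T u z r m \<longleftrightarrow>
    (\<forall>x\<in>cball z r. \<forall>t\<in>{0<..T}. \<exists>G. set_integrable lebesgue {y. r \<le> dist x y} G \<and>
      (LINT y:{y. r \<le> dist x y}|lebesgue. G y) \<le> m t \<and>
      (\<forall>y. r \<le> dist x y \<longrightarrow> u (y, t) / norm (x - y) powr (real CARD('n) + 2 * s) \<le> G y))"

text \<open>
  \<open>A\<close> is a nonnegative continuous function whose lower left derivative is at least \<open>m \<ge> 0\<close>
  at every point of \<open>(0,T]\<close>. The indefinite integral of an integrable lower
  semicontinuous function \<open>m \<ge> 0\<close> has this property, even where \<open>m\<close> is discontinuous.
\<close>
definition upper_primitive :: "real \<Rightarrow> (real \<Rightarrow> real) \<Rightarrow> (real \<Rightarrow> real) \<Rightarrow> bool"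
  where "upper_primitive T m A \<longleftrightarrow>
    continuous_on {0..T} A \<and> (\<forall>t\<in>{0..T}. 0 \<le> A t) \<and>
    (\<forall>t\<in>{0<..T}. 0 \<le> m t \<and>
      (\<forall>\<eta>>0. \<forall>\<^sub>F \<tau> in at_left t. (t - \<tau>) * (m t - \<eta>) \<le> A t - A \<tau>))"

text \<open>
  The barrier is \<open>U |x - z|\<^sup>2 / r\<^sup>2 + B(t)\<close> with \<open>B(t) = c (U Q t / r\<^sup>2 + A(t)) / \<mu> + \<delta> t\<close>, where \<open>Q\<close>
  bounds the integral of \<open>|x - y| powr (2 - p)\<close> over balls of radius \<open>r\<close>. The difference of \<open>u\<close> and
  the barrier cannot have a positive maximum over the closed ball of radius \<open>r\<close> and \<open>[0,T]\<close>: at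
  the maximum point the equation gives an upper bound for \<open>\<partial>\<^sub>t u\<close>, the slope of \<open>B\<close> from the left a lower bound that
  exceeds it by at least \<open>\<delta>/2\<close>. Centres \<open>x\<close> close to the boundary see values of \<open>u\<close> up to distance \<open>2r\<close>
  from \<open>z\<close>; hence the radius in the bound by \<open>U\<close>.
\<close>
lemma comparison_in_ball:
  fixes u :: "(real^'n) \<times> real \<Rightarrow> real" and m A :: "real \<Rightarrow> real" and z :: "real^'n" and s :: real
  defines "p \<equiv> real CARD('n) + 2 * s"
  assumes sol: "pv_solution c \<rho> s T u" and c: "0 \<le> c"
    and cont: "continuous_on (S_bar T) u" and init: "\<And>x. u (x, 0) = 0"
    and r: "0 < r" and U: "0 \<le> U" and \<mu>: "0 < \<mu>" and Q0: "0 \<le> Q"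
    and bd: "\<And>y t. \<lbrakk>y \<in> cball z (2 * r); t \<in> {0<..T}\<rbrakk> \<Longrightarrow> u (y, t) \<le> U"
    and rho: "\<And>y. y \<in> cball z r \<Longrightarrow> \<mu> \<le> \<rho> y"
    and quad: "\<And>x::real^'n. set_integrable lebesgue (ball x r) (\<lambda>y. dist x y powr (2 - p))"
      "\<And>x::real^'n. (LINT y:ball x r|lebesgue. dist x y powr (2 - p)) \<le> Q"
    and tail: "far_field_bound s T u z r m" and prim: "upper_primitive T m A"
    and t: "t \<in> {0..T}"
  shows "u (z, t) \<le> c / \<mu> * (U / r\<^sup>2 * Q * t + A t)"
proof -
  define a where "a = U / r\<^sup>2"
  have a0: "0 \<le> a" using U by (simp add: a_def)
  have ar: "a * r\<^sup>2 = U" using r by (simp add: a_def)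
  have m0: "0 \<le> m t" if "t \<in> {0<..T}" for t
    using prim that by (auto simp: upper_primitive_def)
  have contA: "continuous_on {0..T} A" using prim by (simp add: upper_primitive_def)
  have A0: "0 \<le> A t" if "t \<in> {0..T}" for t
    using prim that by (auto simp: upper_primitive_def)
  have growA: "\<forall>\<^sub>F \<tau> in at_left t. (t - \<tau>) * (m t - \<eta>) \<le> A t - A \<tau>"
    if "t \<in> {0<..T}" "0 < \<eta>" for t \<eta>
    using prim that unfolding upper_primitive_def by blast
  have bd': "u (y, t) \<le> U" if "y \<in> cball z (2 * r)" "t \<in> {0..T}" for y t
    using bd[of y t] that init U by (cases "t = 0") auto
  have main: "u (z, t) \<le> c / \<mu> * (a * Q * t + A t) + \<delta> * t" if \<delta>: "0 < \<delta>" for \<delta>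
  proof (rule ccontr)
    assume contr: "\<not> ?thesis"
    define B where "B = (\<lambda>t. c / \<mu> * (a * Q * t + A t) + \<delta> * t)"
    define F where "F = (\<lambda>(y, \<tau>). u (y, \<tau>) - a * (dist z y)\<^sup>2 - B \<tau>)"
    have B0: "0 \<le> B \<tau>" if "\<tau> \<in> {0..T}" for \<tau>
      using that A0[OF that] a0 Q0 c \<mu> \<delta> by (auto simp: B_def)
    have contu: "continuous_on (cball z r \<times> {0..T}) u"
      by (rule continuous_on_subset[OF cont]) (auto simp: S_bar_def)
    have contF: "continuous_on (cball z r \<times> {0..T}) F"
      unfolding F_def case_prod_unfold B_def
      by (intro continuous_intros continuous_on_compose2[OF contA] continuous_on_compose2[OF contu]) auto
    have zt: "(z, t) \<in> cball z r \<times> {0..T}" using r t by auto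
    then obtain q where q: "q \<in> cball z r \<times> {0..T}" "\<And>q'. q' \<in> cball z r \<times> {0..T} \<Longrightarrow> F q' \<le> F q"
      using continuous_attains_sup[OF _ _ contF] by (metis compact_Times compact_cball compact_Icc empty_iff)
    obtain x0 t0 where q_eq: "q = (x0, t0)" by (cases q)
    have x0: "x0 \<in> cball z r" and t0: "t0 \<in> {0..T}" using q q_eq by auto
    have Fmax: "F (y, \<tau>) \<le> F (x0, t0)" if "y \<in> cball z r" "\<tau> \<in> {0..T}" for y \<tau>
      using q(2)[of "(y, \<tau>)"] that q_eq by auto
    have Fpos: "0 < F (x0, t0)"
      using Fmax[of z t] contr r t by (auto simp: F_def B_def)
    have t0pos: "0 < t0"
    proof (rule ccontr)
      assume "\<not> 0 < t0"
      then have "t0 = 0" using t0 by auto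
      then show False using Fpos init[of x0] B0[of 0] t0 mult_nonneg_nonneg[OF a0, of "(dist z x0)\<^sup>2"]
        by (simp add: F_def)
    qed
    then have t0': "t0 \<in> {0<..T}" using t0 by auto
    have upos: "0 < u (x0, t0)"
      using Fpos B0[OF t0] mult_nonneg_nonneg[OF a0, of "(dist z x0)\<^sup>2"] by (auto simp: F_def)
    obtain D I where D: "((\<lambda>\<tau>. u (x0, \<tau>)) has_real_derivative D) (at t0 within {0<..T})"
      and I: "has_pv_integral (\<lambda>y. (u (x0, t0) - u (y, t0)) / norm (x0 - y) powr p) x0 I"
      and eq: "\<rho> x0 * D + c * I = 0"
      using sol t0' unfolding pv_solution_def p_def by blast
    obtain G where G: "set_integrable lebesgue {y. r \<le> dist x0 y} G"
        "(LINT y:{y. r \<le> dist x0 y}|lebesgue. G y) \<le> m t0"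
        "\<And>y. r \<le> dist x0 y \<Longrightarrow> u (y, t0) / norm (x0 - y) powr p \<le> G y"
      using tail x0 t0' unfolding far_field_bound_def p_def by blast
    have "- (a * Q + m t0) \<le> I"
    proof (rule pv_integral_lower_bound[OF I r a0 _ quad G(1,2)])
      fix y assume y: "y \<in> ball x0 r"
      have "F (y, t0) \<le> F (x0, t0)"
      proof (cases "y \<in> cball z r")
        case True
        then show ?thesis using Fmax t0 by auto
      next
        case False
        \<comment> \<open>Outside the closed ball the barrier exceeds \<open>u\<close>, so the maximum is still dominant.\<close>
        have "dist z y \<le> 2 * r"
          using dist_triangle[of z y x0] x0 y by auto
        then have "u (y, t0) \<le> U" using bd' t0 by auto
        also have "U \<le> a * (dist z y)\<^sup>2"
          using False r a0 unfolding ar[symmetric] by (intro mult_left_mono power_mono) auto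
        finally show ?thesis using Fpos B0[OF t0] by (auto simp: F_def)
      qed
      then have "a * ((dist z x0)\<^sup>2 - (dist z y)\<^sup>2) \<le> u (x0, t0) - u (y, t0)"
        by (simp add: F_def algebra_simps)
      moreover have "(dist z x0)\<^sup>2 - (dist z y)\<^sup>2 = - (2 *\<^sub>R (x0 - z) \<bullet> (y - x0)) - (dist x0 y)\<^sup>2"
        by (simp add: dist_norm power2_norm_eq_inner inner_diff_left inner_diff_right inner_commute algebra_simps)
      ultimately show "- ((a *\<^sub>R (2 *\<^sub>R (x0 - z))) \<bullet> (y - x0)) - a * (dist x0 y)\<^sup>2 \<le> u (x0, t0) - u (y, t0)"
        by (simp add: algebra_simps)
    next
      fix y assume y: "r \<le> dist x0 y"
      have "- G y \<le> - (u (y, t0) / norm (x0 - y) powr p)" using G(3)[OF y] by simp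
      also have "\<dots> \<le> (u (x0, t0) - u (y, t0)) / norm (x0 - y) powr p"
        using upos by (simp add: divide_simps)
      finally show "- G y \<le> (u (x0, t0) - u (y, t0)) / norm (x0 - y) powr p" .
    qed
    then have "c * - (a * Q + m t0) \<le> c * I" using c by (rule mult_left_mono)
    then have up: "\<rho> x0 * D \<le> c * (a * Q + m t0)" using eq by (simp add: algebra_simps)
    have "\<mu> * D \<le> c * (a * Q + m t0)"
    proof (cases "0 \<le> D")
      case True
      then have "\<mu> * D \<le> \<rho> x0 * D" using rho[OF x0] by (intro mult_right_mono)
      then show ?thesis using up by simp
    next
      case False
      then have "\<mu> * D \<le> 0" using \<mu> by (simp add: mult_le_0_iff)
      also have "0 \<le> c * (a * Q + m t0)" using c a0 Q0 m0[OF t0'] by simp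
      finally show ?thesis .
    qed
    then have D_up: "D \<le> c / \<mu> * (a * Q + m t0)" using \<mu> by (simp add: field_simps)
    \<comment> \<open>Small enough for the loss of \<open>\<eta>\<close> in the slope of \<open>A\<close> to be absorbed by \<open>\<delta>\<close>.\<close>
    define \<eta> where "\<eta> = \<delta> * \<mu> / (2 * (c + 1))"
    have \<eta>: "0 < \<eta>" using \<delta> \<mu> c by (simp add: \<eta>_def)
    have c\<eta>: "c / \<mu> * \<eta> \<le> \<delta> / 2"
      using \<delta> \<mu> c by (simp add: \<eta>_def field_simps)
    have "c / \<mu> * (a * Q + (m t0 - \<eta>)) + \<delta> \<le> D"
    proof (rule left_difference_quotient_le_derivative[OF D t0pos])
      have "\<forall>\<^sub>F \<tau> in at_left t0. 0 < \<tau> \<and> \<tau> < t0"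
        using t0pos by (auto simp: eventually_at_left_field)
      with growA[OF t0' \<eta>]
      show "\<forall>\<^sub>F \<tau> in at_left t0. (t0 - \<tau>) * (c / \<mu> * (a * Q + (m t0 - \<eta>)) + \<delta>) \<le> u (x0, t0) - u (x0, \<tau>)"
      proof eventually_elim
        case (elim \<tau>)
        have "(t0 - \<tau>) * (c / \<mu> * (a * Q + (m t0 - \<eta>)) + \<delta>)
            = c / \<mu> * (a * Q * (t0 - \<tau>) + (t0 - \<tau>) * (m t0 - \<eta>)) + \<delta> * (t0 - \<tau>)"
          using \<mu> by (simp add: field_simps)
        also have "\<dots> \<le> c / \<mu> * (a * Q * (t0 - \<tau>) + (A t0 - A \<tau>)) + \<delta> * (t0 - \<tau>)"
          using elim c \<mu> by (intro add_right_mono mult_left_mono add_left_mono) auto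
        also have "\<dots> = B t0 - B \<tau>" using \<mu> by (simp add: B_def field_simps)
        also have "\<dots> \<le> u (x0, t0) - u (x0, \<tau>)"
          using Fmax[OF x0, of \<tau>] elim t0' by (auto simp: F_def)
        finally show ?case .
      qed
    qed (use t0 in auto)
    moreover have "c / \<mu> * (a * Q + (m t0 - \<eta>)) = c / \<mu> * (a * Q + m t0) - c / \<mu> * \<eta>"
      by (simp add: algebra_simps)
    ultimately show False using D_up c\<eta> \<delta> by linarith
  qed
  show ?thesis
  proof (rule field_le_epsilon)
    fix e :: real assume e: "0 < e"
    have "e * t \<le> e * (T + 1)" using e t by (intro mult_left_mono) auto
    then have "e / (T + 1) * t \<le> e" using t by (simp add: pos_divide_le_eq)
    moreover have "0 < e / (T + 1)" using e t by auto
    ultimately show "u (z, t) \<le> c / \<mu> * (U / r\<^sup>2 * Q * t + A t) + e"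
      using main[of "e / (T + 1)"] by (simp add: a_def)
  qed
qed

text \<open>
  Decay at infinity places the maximum of \<open>u - \<epsilon> t\<close>, if positive, at a point \<open>(x\<^sub>0, t\<^sub>0)\<close> that is a
  maximum over the whole space. There the principal value is nonnegative, so \<open>\<partial>\<^sub>t u \<le> 0\<close>, while
  maximality in time gives \<open>\<partial>\<^sub>t u \<ge> \<epsilon>\<close>.
\<close>
lemma maximum_principle_decaying:
  fixes u :: "(real^'n) \<times> real \<Rightarrow> real"
  assumes sol: "pv_solution c \<rho> s T u" and c: "0 \<le> c" and rho: "\<And>x. 0 < \<rho> x"
    and cont: "continuous_on (S_bar T) u" and init: "\<And>x. u (x, 0) = 0"
    and decay: "\<And>e. 0 < e \<Longrightarrow> \<exists>R. \<forall>x t. R \<le> norm x \<longrightarrow> t \<in> {0..T} \<longrightarrow> u (x, t) \<le> e"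
    and t: "t \<in> {0..T}"
  shows "u (z, t) \<le> 0"
proof (rule ccontr)
  assume "\<not> u (z, t) \<le> 0"
  then have upos: "0 < u (z, t)" by simp
  then have T: "0 < T" using t init by (cases "T = 0") auto
  define \<epsilon> where "\<epsilon> = u (z, t) / (2 * T)"
  have \<epsilon>: "0 < \<epsilon>" using upos T by (simp add: \<epsilon>_def)
  define F where "F = (\<lambda>(y, \<tau>). u (y, \<tau>) - \<epsilon> * \<tau>)"
  have "\<epsilon> * t \<le> u (z, t) / 2" using t T upos by (simp add: \<epsilon>_def field_simps)
  then have Fz: "0 < F (z, t)" using upos by (simp add: F_def)
  obtain R where R': "\<forall>x \<tau>. R \<le> norm x \<longrightarrow> \<tau> \<in> {0..T} \<longrightarrow> u (x, \<tau>) \<le> F (z, t) / 2"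
    using decay[OF half_gt_zero[OF Fz]] ..
  have R: "u (x, \<tau>) \<le> F (z, t) / 2" if "R \<le> norm x" "\<tau> \<in> {0..T}" for x \<tau>
    using R' that by simp
  have F_le: "F (x, \<tau>) \<le> u (x, \<tau>)" if "\<tau> \<in> {0..T}" for x \<tau>
    using that \<epsilon> by (simp add: F_def)
  have zR: "norm z < R"
  proof (rule ccontr)
    assume "\<not> norm z < R"
    then have "u (z, t) \<le> F (z, t) / 2" using R t by simp
    then show False using F_le[OF t, of z] Fz by linarith
  qed
  have contu: "continuous_on (cball 0 R \<times> {0..T}) u"
    by (rule continuous_on_subset[OF cont]) (auto simp: S_bar_def)
  have contF: "continuous_on (cball 0 R \<times> {0..T}) F"
    unfolding F_def case_prod_unfold
    by (intro continuous_intros continuous_on_compose2[OF contu]) auto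
  have zt: "(z, t) \<in> cball 0 R \<times> {0..T}" using zR t by auto
  then obtain q where q: "q \<in> cball 0 R \<times> {0..T}" "\<And>q'. q' \<in> cball 0 R \<times> {0..T} \<Longrightarrow> F q' \<le> F q"
    using continuous_attains_sup[OF _ _ contF] by (metis compact_Times compact_cball compact_Icc empty_iff)
  obtain x0 t0 where q_eq: "q = (x0, t0)" by (cases q)
  have t0: "t0 \<in> {0..T}" using q q_eq by auto
  have Fx0: "F (z, t) \<le> F (x0, t0)" using q(2)[OF zt] q_eq by simp
  have Fmax: "F (y, \<tau>) \<le> F (x0, t0)" if \<tau>: "\<tau> \<in> {0..T}" for y \<tau>
  proof (cases "norm y \<le> R")
    case True
    then show ?thesis using q(2)[of "(y, \<tau>)"] \<tau> q_eq by auto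
  next
    case False
    then have "F (y, \<tau>) \<le> F (z, t) / 2"
      using R[OF _ \<tau>, of y] F_le[OF \<tau>, of y] by simp
    then show ?thesis using Fx0 Fz by linarith
  qed
  have "t0 \<noteq> 0" using Fx0 Fz init[of x0] by (auto simp: F_def)
  then have t0': "0 < t0" "t0 \<in> {0<..T}" using t0 by auto
  obtain D I where D: "((\<lambda>\<tau>. u (x0, \<tau>)) has_real_derivative D) (at t0 within {0<..T})"
    and I: "has_pv_integral (\<lambda>y. (u (x0, t0) - u (y, t0)) / norm (x0 - y) powr (real CARD('n) + 2 * s)) x0 I"
    and eq: "\<rho> x0 * D + c * I = 0"
    using sol t0' unfolding pv_solution_def by blast
  have "0 \<le> I"
    using Fmax[OF t0] by (intro pv_integral_nonneg_at_max[OF I]) (auto simp: F_def)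
  then have "\<rho> x0 * D \<le> 0" using eq c mult_nonneg_nonneg[of c I] by linarith
  then have "D \<le> 0" using rho[of x0] by (simp add: mult_le_0_iff)
  moreover have "\<epsilon> \<le> D"
  proof (rule left_difference_quotient_le_derivative[OF D t0'(1)])
    have "\<forall>\<^sub>F \<tau> in at_left t0. 0 < \<tau> \<and> \<tau> < t0"
      using t0' by (auto simp: eventually_at_left_field)
    then show "\<forall>\<^sub>F \<tau> in at_left t0. (t0 - \<tau>) * \<epsilon> \<le> u (x0, t0) - u (x0, \<tau>)"
    proof eventually_elim
      case (elim \<tau>)
      then show ?case using Fmax[of \<tau> x0] t0 by (auto simp: F_def algebra_simps)
    qed
  qed (use t0 in auto)
  ultimately show False using \<epsilon> by linarith
qed

section \<open>Solutions and the normalising constant\<close>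

lemma pv_solution_uminus:
  fixes u :: "(real^'n) \<times> real \<Rightarrow> real"
  assumes "pv_solution c \<rho> s T u"
  shows "pv_solution c \<rho> s T (\<lambda>q. - u q)"
  unfolding pv_solution_def
proof (intro allI ballI)
  fix x :: "real^'n" and t assume t: "t \<in> {0<..T}"
  let ?f = "\<lambda>y. (u (x, t) - u (y, t)) / norm (x - y) powr (real CARD('n) + 2 * s)"
  obtain D I where D: "((\<lambda>\<tau>. u (x, \<tau>)) has_real_derivative D) (at t within {0<..T})"
      and I: "has_pv_integral ?f x I" and eq: "\<rho> x * D + c * I = 0"
    using assms t unfolding pv_solution_def by blast
  have "(\<lambda>y. (- u (x, t) - - u (y, t)) / norm (x - y) powr (real CARD('n) + 2 * s)) = (\<lambda>y. - ?f y)"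
    by (simp add: fun_eq_iff diff_divide_distrib)
  moreover have "has_pv_integral (\<lambda>y. - ?f y) x (- I)"
    using I unfolding has_pv_integral_def set_lebesgue_integral_def set_integrable_def
    by (auto intro: tendsto_minus)
  ultimately show "\<exists>D I. ((\<lambda>\<tau>. - u (x, \<tau>)) has_real_derivative D) (at t within {0<..T}) \<and>
      has_pv_integral (\<lambda>y. (- u (x, t) - - u (y, t)) / norm (x - y) powr (real CARD('n) + 2 * s)) x I \<and>
      \<rho> x * D + c * I = 0"
    using DERIV_minus[OF D] eq by (intro exI[of _ "- D"] exI[of _ "- I"]) auto
qed

lemma equation_solution_imp_pv_solution:
  fixes u :: "(real^'n) \<times> real \<Rightarrow> real"
  assumes "equation_solution \<rho> s T u"
  shows "pv_solution (frac_const TYPE('n) s) \<rho> s T u"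
  unfolding pv_solution_def
proof (intro allI ballI)
  fix x :: "real^'n" and t assume t: "t \<in> {0<..T}"
  then have xt: "(x, t) \<in> S_cyl T" by (auto simp: S_cyl_def)
  have "(\<lambda>\<tau>. u (x, \<tau>)) differentiable (at t within {0<..T})"
    using assms xt unfolding equation_solution_def by blast
  then have "((\<lambda>\<tau>. u (x, \<tau>)) has_real_derivative time_deriv T u (x, t)) (at t within {0<..T})"
    by (simp add: time_deriv_def has_real_derivative_iff_has_vector_derivative vector_derivative_works)
  moreover obtain L where "has_frac_laplacian s (\<lambda>y. u (y, t)) x L" "\<rho> x * time_deriv T u (x, t) + L = 0"
    using assms xt unfolding equation_solution_def by blast
  ultimately show "\<exists>D I. ((\<lambda>\<tau>. u (x, \<tau>)) has_real_derivative D) (at t within {0<..T}) \<and>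
      has_pv_integral (\<lambda>y. (u (x, t) - u (y, t)) / norm (x - y) powr (real CARD('n) + 2 * s)) x I \<and>
      \<rho> x * D + frac_const TYPE('n) s * I = 0"
    unfolding has_frac_laplacian_def by blast
qed

text \<open>
  A divergent defining integral would have the value \<open>0\<close>, and so would its inverse; hence no
  convergence argument is required.
\<close>
lemma frac_const_nonneg: "0 \<le> frac_const TYPE('n::finite) s"
  unfolding frac_const_def frac_const_integral_def
  by (intro iffD2[OF inverse_nonnegative_iff_nonnegative] Bochner_Integration.integral_nonneg) simp

section \<open>Decay at infinity\<close>

lemma Ls_norm_nonneg: "0 \<le> Ls_norm s v"
  unfolding Ls_norm_def by (intro Bochner_Integration.integral_nonneg) auto

text \<open>
  By Fatou's lemma along sequences \<open>\<tau> \<rightarrow> t\<close>. Integrability at every time, rather than at almost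
  every time, is used to rule out infinite norms, which \<open>Ls_norm\<close> would represent by \<open>0\<close>.
\<close>
lemma Ls_norm_lower_semicontinuous:
  fixes u :: "(real^'n) \<times> real \<Rightarrow> real"
  assumes cont: "continuous_on (S_cyl T) u"
    and Ls: "\<And>t. t \<in> {0<..T} \<Longrightarrow> (\<lambda>x. u (x, t)) \<in> Ls_space s"
    and t: "t \<in> {0<..T}" and \<eta>: "0 < \<eta>"
  shows "\<forall>\<^sub>F \<tau> in at t within {0<..T}. Ls_norm s (\<lambda>x. u (x, t)) - \<eta> < Ls_norm s (\<lambda>x. u (x, \<tau>))"
proof (rule sequentially_imp_eventually_within, intro allI impI)
  fix f :: "nat \<Rightarrow> real"
  assume f: "(\<forall>n. f n \<in> {0<..T} \<and> f n \<noteq> t) \<and> f \<longlonglongrightarrow> t"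
  define g where "g = (\<lambda>\<tau> x. \<bar>u (x, \<tau>)\<bar> / (1 + norm x powr (real CARD('n) + 2 * s)))"
  define m where "m = (\<lambda>\<tau>. Ls_norm s (\<lambda>x. u (x, \<tau>)))"
  have int: "integrable lebesgue (g \<tau>)" if "\<tau> \<in> {0<..T}" for \<tau>
    using Ls[OF that] by (simp add: Ls_space_def g_def)
  have nn: "(\<integral>\<^sup>+x. ennreal (g \<tau> x) \<partial>lebesgue) = ennreal (m \<tau>)" if "\<tau> \<in> {0<..T}" for \<tau>
    using int[OF that] unfolding m_def Ls_norm_def g_def by (intro nn_integral_eq_integral) auto
  have lim: "(\<lambda>n. ennreal (g (f n) x)) \<longlonglongrightarrow> ennreal (g t x)" for x
  proof -
    have "(\<lambda>n. u (x, f n)) \<longlonglongrightarrow> u (x, t)"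
    proof (rule continuous_on_tendsto_compose[OF cont])
      show "(\<lambda>n. (x, f n)) \<longlonglongrightarrow> (x, t)" using f by (intro tendsto_intros) auto
    qed (use f t in \<open>auto simp: S_cyl_def\<close>)
    then show ?thesis
      unfolding g_def by (intro tendsto_ennrealI tendsto_divide tendsto_rabs tendsto_const) (auto simp: add_nonneg_eq_0_iff)
  qed
  have "ennreal (m t) = (\<integral>\<^sup>+x. liminf (\<lambda>n. ennreal (g (f n) x)) \<partial>lebesgue)"
    unfolding nn[OF t, symmetric] by (intro nn_integral_cong lim_imp_Liminf[OF sequentially_bot lim, symmetric])
  also have "\<dots> \<le> liminf (\<lambda>n. \<integral>\<^sup>+x. ennreal (g (f n) x) \<partial>lebesgue)"
    using int f by (intro nn_integral_liminf) (auto dest: borel_measurable_integrable)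
  also have "\<dots> = liminf (\<lambda>n. ennreal (m (f n)))"
    using nn f by simp
  finally have le: "ennreal (m t) \<le> liminf (\<lambda>n. ennreal (m (f n)))" .
  have m0: "0 \<le> m \<tau>" for \<tau> by (simp add: m_def Ls_norm_nonneg)
  have m_eq: "Ls_norm s (\<lambda>x. u (x, \<tau>)) = m \<tau>" for \<tau> by (simp add: m_def)
  show "\<forall>\<^sub>F n in sequentially. Ls_norm s (\<lambda>x. u (x, t)) - \<eta> < Ls_norm s (\<lambda>x. u (x, f n))"
  proof (cases "m t - \<eta> < 0")
    case True
    then show ?thesis
      unfolding m_eq using m0 by (intro always_eventually allI) (rule order_less_le_trans)
  next
    case False
    then have "ennreal (m t - \<eta>) < ennreal (m t)" using \<eta> by (simp add: ennreal_less_iff)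
    then have "\<forall>\<^sub>F n in sequentially. ennreal (m t - \<eta>) < ennreal (m (f n))"
      using le by (intro less_LiminfD) auto
    then show ?thesis
      unfolding m_eq using False by (simp add: ennreal_less_iff)
  qed
qed

text \<open>
  The comparison in the ball of radius \<open>|z|/4\<close> about \<open>z\<close>, with the powers of \<open>|z|\<close> collected. The
  constant \<open>k\<close> depends neither on \<open>z\<close> nor on the far field.
\<close>
lemma interior_estimate:
  fixes u :: "(real^'n) \<times> real \<Rightarrow> real" and s :: real
  defines "p \<equiv> real CARD('n) + 2 * s"
  assumes s: "s < 1" and T: "0 \<le> T" and K: "0 < K"
    and rho: "\<And>x. K * (1 + (norm x)\<^sup>2) powr (- \<alpha> / 2) \<le> \<rho> x"
    and sol: "pv_solution c \<rho> s T u" and c: "0 \<le> c"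
    and cont: "continuous_on (S_bar T) u" and init: "\<And>x. u (x, 0) = 0"
    and \<sigma>: "0 \<le> \<sigma>" and C: "0 \<le> C"
    and bd: "\<And>x t. t \<in> {0<..T} \<Longrightarrow> \<bar>u (x, t)\<bar> \<le> C * (1 + (norm x)\<^sup>2) powr (\<sigma> / 2)"
  obtains k where "0 \<le> k"
    and "\<And>z t m A. \<lbrakk>1 \<le> norm z; t \<in> {0..T};
        far_field_bound s T u z (norm z / 4) m; upper_primitive T m A\<rbrakk>
      \<Longrightarrow> u (z, t) \<le> k * norm z powr \<alpha> * (norm z powr (\<sigma> - 2 * s) + A t)"
proof -
  have "- real DIM(real^'n) < 2 - p" using s by (simp add: p_def)
  then obtain kq where kq: "0 \<le> kq"
      "\<And>(x::real^'n) r. 0 < r \<Longrightarrow> set_integrable lebesgue (ball x r) (\<lambda>y. dist x y powr (2 - p))"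
      "\<And>(x::real^'n) r. 0 < r \<Longrightarrow>
        (LINT y:ball x r|lebesgue. dist x y powr (2 - p)) \<le> kq * r powr (2 - p + real DIM(real^'n))"
    using power_kernel_inside[where 'a = "real^'n"] by blast
  define h where "h = 4 powr (\<bar>\<alpha>\<bar> / 2)"
  have h: "0 < h" by (simp add: h_def)
  define k1 where "k1 = C * 2 powr \<sigma> * 16 * kq * T"
  have k1: "0 \<le> k1" using C kq T by (simp add: k1_def)
  define k where "k = c * h / K * (k1 + 1)"
  show thesis
  proof (rule that[of k])
    show "0 \<le> k" using c h K k1 by (simp add: k_def)
    fix z :: "real^'n" and t and m A :: "real \<Rightarrow> real"
    assume z: "1 \<le> norm z" and t: "t \<in> {0..T}"
      and tail: "far_field_bound s T u z (norm z / 4) m" and prim: "upper_primitive T m A"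
    have At: "0 \<le> A t" using prim t by (auto simp: upper_primitive_def)
    define R where "R = norm z"
    define r where "r = R / 4"
    have R: "1 \<le> R" and r: "0 < r" using z by (auto simp: R_def r_def)
    define U where "U = C * (2 powr \<sigma> * R powr \<sigma>)"
    define \<mu> where "\<mu> = K / h * R powr (- \<alpha>)"
    define Q where "Q = kq * r powr (2 - 2 * s)"
    have norm_y: "norm y \<le> R + d" "R - d \<le> norm y" if "y \<in> cball z d" for y d
      using norm_triangle_ineq2[of y z] norm_triangle_ineq2[of z y] that
      by (auto simp: R_def dist_norm norm_minus_commute)
    have "u (z, t) \<le> c / \<mu> * (U / r\<^sup>2 * Q * t + A t)"
    proof (rule comparison_in_ball[OF sol c cont init r])
      show "0 \<le> U" using C by (simp add: U_def)
      show "0 < \<mu>" using K h R by (simp add: \<mu>_def)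
      show "0 \<le> Q" using kq by (simp add: Q_def)
      fix y t assume y: "y \<in> cball z (2 * r)" and t: "t \<in> {0<..T}"
      have "norm y \<le> 3 / 2 * R" using norm_y(1)[OF y] by (simp add: r_def)
      then have "(norm y)\<^sup>2 \<le> (3 / 2 * R)\<^sup>2" by (intro power_mono) auto
      moreover have "1 \<le> R\<^sup>2" using R by simp
      ultimately have "1 + (norm y)\<^sup>2 \<le> (2 * R)\<^sup>2"
        by (simp add: power_mult_distrib power_divide)
      then have "(1 + (norm y)\<^sup>2) powr (\<sigma> / 2) \<le> ((2 * R)\<^sup>2) powr (\<sigma> / 2)"
        using \<sigma> by (intro powr_mono2) auto
      also have "\<dots> = 2 powr \<sigma> * R powr \<sigma>"
        using R by (simp add: powr_powr powr_mult flip: powr_numeral)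
      finally have "C * (1 + (norm y)\<^sup>2) powr (\<sigma> / 2) \<le> U"
        using C unfolding U_def by (intro mult_left_mono)
      then show "u (y, t) \<le> U" using bd[OF t, of y] by linarith
    next
      fix y assume y: "y \<in> cball z r"
      have ny: "R / 2 \<le> norm y" "norm y \<le> 3 / 2 * R" using norm_y[OF y] R by (auto simp: r_def)
      \<comment> \<open>\<open>1 + |y|\<^sup>2\<close> is comparable to \<open>R\<^sup>2\<close> in both directions, so the sign of \<open>\<alpha>\<close> is irrelevant here.\<close>
      define q where "q = (1 + (norm y)\<^sup>2) / R\<^sup>2"
      have "(norm y)\<^sup>2 \<le> (3 / 2 * R)\<^sup>2" using ny by (intro power_mono) auto
      moreover have "(R / 2)\<^sup>2 \<le> (norm y)\<^sup>2" using ny R by (intro power_mono) auto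
      moreover have "1 \<le> R\<^sup>2" using R by simp
      ultimately have "R\<^sup>2 / 4 \<le> 1 + (norm y)\<^sup>2" "1 + (norm y)\<^sup>2 \<le> 4 * R\<^sup>2"
        by (simp_all add: power_mult_distrib power_divide)
      then have q: "1 / 4 \<le> q" "q \<le> 4" using R by (auto simp: q_def field_simps)
      have "1 / h \<le> q powr (- \<alpha> / 2)"
      proof (cases "0 \<le> \<alpha>")
        case True
        have "1 / h = 4 powr (- \<alpha> / 2)" using True by (simp add: h_def powr_minus_divide)
        also have "\<dots> \<le> q powr (- \<alpha> / 2)" using q True by (intro powr_mono2') auto
        finally show ?thesis .
      next
        case False
        have "1 / h = (1 / 4) powr (- \<alpha> / 2)" using False by (simp add: h_def powr_divide)
        also have "\<dots> \<le> q powr (- \<alpha> / 2)" using q False by (intro powr_mono2) auto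
        finally show ?thesis .
      qed
      then have "K * (1 / h * R powr (- \<alpha>)) \<le> K * (q powr (- \<alpha> / 2) * R powr (- \<alpha>))"
        using K by (intro mult_left_mono mult_right_mono) auto
      then have "\<mu> \<le> K * (q powr (- \<alpha> / 2) * R powr (- \<alpha>))" by (simp add: \<mu>_def)
      also have "q powr (- \<alpha> / 2) * R powr (- \<alpha>) = q powr (- \<alpha> / 2) * (R\<^sup>2) powr (- \<alpha> / 2)"
        using R by (simp add: powr_powr flip: powr_numeral)
      also have "\<dots> = (q * R\<^sup>2) powr (- \<alpha> / 2)" using q by (simp add: powr_mult)
      also have "q * R\<^sup>2 = 1 + (norm y)\<^sup>2" using R by (simp add: q_def)
      finally show "\<mu> \<le> \<rho> y" using rho[of y] by linarith
    next
      fix x :: "real^'n"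
      show "set_integrable lebesgue (ball x r) (\<lambda>y. dist x y powr (2 - (real CARD('n) + 2 * s)))"
        using kq(2)[OF r] by (simp add: p_def)
      show "(LINT y:ball x r|lebesgue. dist x y powr (2 - (real CARD('n) + 2 * s))) \<le> Q"
        using kq(3)[OF r, of x] by (simp add: p_def Q_def)
    next
      show "far_field_bound s T u z r m" using tail by (simp add: r_def R_def)
    qed (use prim t in auto)
    also have "c / \<mu> = c * h / K * R powr \<alpha>"
      using R by (simp add: \<mu>_def powr_minus divide_inverse)
    also have "c * h / K * R powr \<alpha> * (U / r\<^sup>2 * Q * t + A t)
        \<le> c * h / K * R powr \<alpha> * ((k1 + 1) * (R powr (\<sigma> - 2 * s) + A t))"
    proof (intro mult_left_mono)
      have "U / r\<^sup>2 * Q * t = C * 2 powr \<sigma> * kq * t * (R powr \<sigma> * r powr (2 - 2 * s) / r\<^sup>2)"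
        by (simp add: U_def Q_def)
      also have "R powr \<sigma> * r powr (2 - 2 * s) / r\<^sup>2 = R powr \<sigma> * r powr (- 2 * s)"
        using r by (simp add: powr_diff powr_minus field_simps)
      also have "r powr (- 2 * s) = 4 powr (2 * s) * R powr (- 2 * s)"
        using R by (simp add: r_def powr_divide powr_minus_divide)
      also have "C * 2 powr \<sigma> * kq * t * (R powr \<sigma> * (4 powr (2 * s) * R powr (- 2 * s)))
          = C * 2 powr \<sigma> * 4 powr (2 * s) * kq * t * R powr (\<sigma> - 2 * s)"
        using powr_add[of R \<sigma> "- 2 * s"] by simp
      also have "\<dots> \<le> C * 2 powr \<sigma> * 16 * kq * T * R powr (\<sigma> - 2 * s)"
      proof -
        have "4 powr (2 * s) \<le> (4::real) powr 2" using s by (intro powr_mono) auto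
        then have "4 powr (2 * s) \<le> (16::real)" by simp
        then show ?thesis using C kq t by (intro mult_right_mono mult_mono) auto
      qed
      also have "\<dots> = k1 * R powr (\<sigma> - 2 * s)" by (simp add: k1_def)
      finally have "U / r\<^sup>2 * Q * t \<le> k1 * R powr (\<sigma> - 2 * s)" .
      moreover have "0 \<le> k1 * A t" "0 \<le> R powr (\<sigma> - 2 * s)" using k1 At by auto
      ultimately show "U / r\<^sup>2 * Q * t + A t \<le> (k1 + 1) * (R powr (\<sigma> - 2 * s) + A t)"
        by (simp only: distrib_right distrib_left mult_1_left)
      show "0 \<le> c * h / K * R powr \<alpha>" using c h K by simp
    qed
    also have "\<dots> = k * norm z powr \<alpha> * (norm z powr (\<sigma> - 2 * s) + A t)"
      by (simp add: k_def R_def)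
    finally show "u (z, t) \<le> k * norm z powr \<alpha> * (norm z powr (\<sigma> - 2 * s) + A t)" .
  qed
qed

lemma norm_le_dist_outside:
  fixes x y z :: "'a::real_normed_vector"
  assumes "x \<in> cball z (norm z / 4)" and "norm z / 4 \<le> dist x y"
  shows "norm y \<le> 6 * dist x y"
proof -
  have "norm x \<le> norm z + norm z / 4"
    using assms(1) norm_triangle_ineq2[of x z] by (simp add: dist_norm norm_minus_commute)
  moreover have "norm y \<le> norm x + dist x y"
    using norm_triangle_ineq2[of y x] by (simp add: dist_norm norm_minus_commute)
  ultimately show ?thesis using assms(2) by linarith
qed

text \<open>
  For \<open>\<sigma> < 2s\<close> the growth bound alone controls the far field: at distance at least \<open>|z|/4\<close> from \<open>x\<close>
  it is dominated by a multiple of \<open>|x - y| powr (\<sigma> - N - 2s)\<close>, which is integrable there.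
\<close>
lemma decay_of_subcritical_growth:
  fixes u :: "(real^'n) \<times> real \<Rightarrow> real"
  assumes s: "s < 1" and T: "0 \<le> T" and K: "0 < K"
    and rho: "\<And>x. K * (1 + (norm x)\<^sup>2) powr (- \<alpha> / 2) \<le> \<rho> x"
    and sol: "pv_solution c \<rho> s T u" and c: "0 \<le> c"
    and cont: "continuous_on (S_bar T) u" and init: "\<And>x. u (x, 0) = 0"
    and \<sigma>: "0 \<le> \<sigma>" "\<sigma> < 2 * s" and C: "0 \<le> C"
    and bd: "\<And>x t. t \<in> {0<..T} \<Longrightarrow> \<bar>u (x, t)\<bar> \<le> C * (1 + (norm x)\<^sup>2) powr (\<sigma> / 2)"
  obtains k where "0 \<le> k"
    and "\<And>z t. \<lbrakk>1 \<le> norm z; t \<in> {0..T}\<rbrakk> \<Longrightarrow> u (z, t) \<le> k * norm z powr (\<sigma> - 2 * s + \<alpha>)"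
proof -
  define p where "p = real CARD('n) + 2 * s"
  obtain k where k: "0 \<le> k" and est: "\<And>z t m A. \<lbrakk>1 \<le> norm z; t \<in> {0..T};
        far_field_bound s T u z (norm z / 4) m; upper_primitive T m A\<rbrakk>
      \<Longrightarrow> u (z, t) \<le> k * norm z powr \<alpha> * (norm z powr (\<sigma> - 2 * s) + A t)"
    using interior_estimate[OF s T K rho sol c cont init \<sigma>(1) C bd] by blast
  have "\<sigma> - p < - real DIM(real^'n)" using \<sigma> by (simp add: p_def)
  then obtain ko where ko: "0 \<le> ko"
      "\<And>(x::real^'n) r. 0 < r \<Longrightarrow> set_integrable lebesgue {y. r \<le> dist x y} (\<lambda>y. dist x y powr (\<sigma> - p))"
      "\<And>(x::real^'n) r. 0 < r \<Longrightarrow>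
        (LINT y:{y. r \<le> dist x y}|lebesgue. dist x y powr (\<sigma> - p)) \<le> ko * r powr (\<sigma> - p + real DIM(real^'n))"
    using power_kernel_outside[where 'a = "real^'n"] by blast
  define b where "b = C * 10 powr \<sigma>"
  have b: "0 \<le> b" using C by (simp add: b_def)
  define k2 where "k2 = b * ko * 4 powr (2 * s - \<sigma>)"
  have k2: "0 \<le> k2" using b ko by (simp add: k2_def)
  show thesis
  proof (rule that[of "k * (1 + k2 * T)"])
    show "0 \<le> k * (1 + k2 * T)" using k k2 T by simp
    fix z :: "real^'n" and t assume z: "1 \<le> norm z" and t: "t \<in> {0..T}"
    define M where "M = k2 * norm z powr (\<sigma> - 2 * s)"
    have M: "0 \<le> M" using k2 by (simp add: M_def)
    have exps: "norm z powr \<alpha> * norm z powr (\<sigma> - 2 * s) = norm z powr (\<sigma> - 2 * s + \<alpha>)"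
      by (simp add: powr_add mult.commute)
    have "u (z, t) \<le> k * norm z powr \<alpha> * (norm z powr (\<sigma> - 2 * s) + M * t)"
    proof (rule est[OF z t])
      show "far_field_bound s T u z (norm z / 4) (\<lambda>_. M)"
        unfolding far_field_bound_def p_def[symmetric]
      proof (intro ballI)
        fix x t assume x: "x \<in> cball z (norm z / 4)" and t: "t \<in> {0<..T}"
        let ?r = "norm z / 4"
        let ?G = "\<lambda>y. b * dist x y powr (\<sigma> - p)"
        have r: "0 < ?r" using z by linarith
        have "set_integrable lebesgue {y. ?r \<le> dist x y} ?G"
          using ko(2)[OF r] by (intro set_integrable_mult_right)
        moreover have "(LINT y:{y. ?r \<le> dist x y}|lebesgue. ?G y) \<le> M"
        proof -
          have "(LINT y:{y. ?r \<le> dist x y}|lebesgue. ?G y)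
              \<le> b * (ko * ?r powr (\<sigma> - p + real DIM(real^'n)))"
            using ko(3)[OF r] b by (simp add: mult_left_mono del: DIM_cart)
          also have "?r powr (\<sigma> - p + real DIM(real^'n)) = 4 powr (2 * s - \<sigma>) * norm z powr (\<sigma> - 2 * s)"
            using z by (simp add: p_def powr_divide powr_diff)
          finally show ?thesis by (simp add: M_def k2_def)
        qed
        moreover have "u (y, t) / norm (x - y) powr p \<le> ?G y" if y: "?r \<le> dist x y" for y
        proof -
          have d: "0 < dist x y" using r y by linarith
          have "1 + norm y \<le> 10 * dist x y"
            using norm_le_dist_outside[OF x y] z y by linarith
          then have "(1 + norm y)\<^sup>2 \<le> (10 * dist x y)\<^sup>2" by (intro power_mono) auto
          then have "1 + (norm y)\<^sup>2 \<le> (10 * dist x y)\<^sup>2"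
            by (simp add: power2_sum) (smt (verit) norm_ge_zero)
          then have "(1 + (norm y)\<^sup>2) powr (\<sigma> / 2) \<le> ((10 * dist x y)\<^sup>2) powr (\<sigma> / 2)"
            using \<sigma> by (intro powr_mono2) auto
          also have "\<dots> = 10 powr \<sigma> * dist x y powr \<sigma>"
            using d by (simp add: powr_powr powr_mult flip: powr_numeral)
          finally have "C * (1 + (norm y)\<^sup>2) powr (\<sigma> / 2) \<le> b * dist x y powr \<sigma>"
            using C by (simp add: b_def mult.assoc mult_left_mono)
          then have "u (y, t) \<le> b * dist x y powr \<sigma>" using bd[OF t, of y] by linarith
          then have "u (y, t) / dist x y powr p \<le> b * dist x y powr \<sigma> / dist x y powr p"
            by (intro divide_right_mono) auto
          then show ?thesis using d by (simp add: powr_diff dist_norm)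
        qed
        ultimately show "\<exists>G. set_integrable lebesgue {y. ?r \<le> dist x y} G \<and>
            (LINT y:{y. ?r \<le> dist x y}|lebesgue. G y) \<le> M \<and>
            (\<forall>y. ?r \<le> dist x y \<longrightarrow> u (y, t) / norm (x - y) powr p \<le> G y)"
          by blast
      qed
    next
      have "\<forall>\<^sub>F \<tau> in at_left t. (t - \<tau>) * (M - \<eta>) \<le> M * t - M * \<tau>" if "0 < \<eta>" for t \<eta> :: real
      proof -
        have "\<forall>\<^sub>F \<tau> in at_left t. \<tau> < t" by (simp add: eventually_at_filter)
        then show ?thesis
          by eventually_elim (use that in \<open>simp add: algebra_simps\<close>)
      qed
      then show "upper_primitive T (\<lambda>_. M) (\<lambda>t. M * t)"
        using M by (auto simp: upper_primitive_def intro!: continuous_intros)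
    qed
    also have "\<dots> \<le> k * norm z powr \<alpha> * (norm z powr (\<sigma> - 2 * s) + M * T)"
      using k t M by (intro mult_left_mono add_mono) auto
    also have "\<dots> = k * (1 + k2 * T) * norm z powr (\<sigma> - 2 * s + \<alpha>)"
      unfolding exps[symmetric] by (simp add: M_def distrib_left distrib_right mult_ac)
    finally show "u (z, t) \<le> k * (1 + k2 * T) * norm z powr (\<sigma> - 2 * s + \<alpha>)" .
  qed
qed

text \<open>
  For arbitrary \<open>\<sigma>\<close> the far field is controlled by the \<open>\<L>\<^sup>s\<close> norm: at distance at least \<open>|z|/4\<close> from
  \<open>x\<close>, \<open>1 + |y| powr (N + 2s)\<close> is at most a constant times \<open>|x - y| powr (N + 2s)\<close>. No decay in \<open>|z|\<close>
  is gained from the far field, so the estimate is useful for \<open>\<alpha> < 0\<close>.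
\<close>
lemma decay_of_integrable_solution:
  fixes u :: "(real^'n) \<times> real \<Rightarrow> real"
  assumes s: "0 \<le> s" "s < 1" and T: "0 \<le> T" and K: "0 < K"
    and rho: "\<And>x. K * (1 + (norm x)\<^sup>2) powr (- \<alpha> / 2) \<le> \<rho> x"
    and sol: "pv_solution c \<rho> s T u" and c: "0 \<le> c"
    and cont: "continuous_on (S_bar T) u" and init: "\<And>x. u (x, 0) = 0"
    and \<sigma>: "0 \<le> \<sigma>" and C: "0 \<le> C"
    and bd: "\<And>x t. t \<in> {0<..T} \<Longrightarrow> \<bar>u (x, t)\<bar> \<le> C * (1 + (norm x)\<^sup>2) powr (\<sigma> / 2)"
    and Ls: "\<And>t. t \<in> {0<..T} \<Longrightarrow> (\<lambda>x. u (x, t)) \<in> Ls_space s"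
    and L1: "set_integrable lebesgue {0<..<T} (\<lambda>t. Ls_norm s (\<lambda>x. u (x, t)))"
  obtains k where "0 \<le> k" and "\<And>z t. \<lbrakk>1 \<le> norm z; t \<in> {0..T}\<rbrakk> \<Longrightarrow>
    u (z, t) \<le> k * (norm z powr (\<sigma> - 2 * s + \<alpha>) + norm z powr \<alpha>)"
proof -
  define p where "p = real CARD('n) + 2 * s"
  have p: "0 \<le> p" using s by (simp add: p_def)
  obtain k where k: "0 \<le> k" and est: "\<And>z t m A. \<lbrakk>1 \<le> norm z; t \<in> {0..T};
        far_field_bound s T u z (norm z / 4) m; upper_primitive T m A\<rbrakk>
      \<Longrightarrow> u (z, t) \<le> k * norm z powr \<alpha> * (norm z powr (\<sigma> - 2 * s) + A t)"
    using interior_estimate[OF s(2) T K rho sol c cont init \<sigma> C bd] by blast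
  define b where "b = 4 powr p + 6 powr p"
  have b: "0 < b" by (simp add: b_def add_pos_pos)
  define l where "l = (\<lambda>t. Ls_norm s (\<lambda>x. u (x, t)))"
  have l0: "0 \<le> l t" for t by (simp add: l_def Ls_norm_nonneg)
  have "l integrable_on {0<..<T}"
    using set_lebesgue_integral_eq_integral(1)[OF L1] by (simp add: l_def)
  then have l_int: "l integrable_on {0..T}" by (simp add: integrable_on_Icc_iff_Ioo)
  have l_sub: "l integrable_on {a..d}" if "0 \<le> a" "d \<le> T" for a d
    using integrable_on_subinterval[OF l_int] that by auto
  define A where "A = (\<lambda>t. b * integral {0..t} l)"
  have A_mono: "A t \<le> A T" if "t \<in> {0..T}" for t
    unfolding A_def using b l0 that l_sub
    by (intro mult_left_mono integral_subset_le) auto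
  have A0: "0 \<le> A t" if "t \<in> {0..T}" for t
    unfolding A_def using b l0 that l_sub by (intro mult_nonneg_nonneg integral_nonneg) auto
  have AT: "0 \<le> A T" using A0[of T] T by simp
  show thesis
  proof (rule that[of "k * (1 + A T)"])
    show "0 \<le> k * (1 + A T)" using k AT by simp
    fix z :: "real^'n" and t assume z: "1 \<le> norm z" and t: "t \<in> {0..T}"
    have "u (z, t) \<le> k * norm z powr \<alpha> * (norm z powr (\<sigma> - 2 * s) + A t)"
    proof (rule est[OF z t])
      show "far_field_bound s T u z (norm z / 4) (\<lambda>t. b * l t)"
        unfolding far_field_bound_def p_def[symmetric]
      proof (intro ballI)
        fix x t assume x: "x \<in> cball z (norm z / 4)" and t: "t \<in> {0<..T}"
        let ?r = "norm z / 4"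
        let ?g = "\<lambda>y. \<bar>u (y, t)\<bar> / (1 + norm y powr p)"
        have g: "integrable lebesgue ?g" using Ls[OF t] by (simp add: Ls_space_def p_def)
        have [measurable]: "{y. ?r \<le> dist x y} \<in> sets lebesgue" by (intro sets_completionI_sets) measurable
        have gs: "set_integrable lebesgue {y. ?r \<le> dist x y} ?g"
          unfolding set_integrable_def using g by (intro integrable_mult_indicator) auto
        then have "set_integrable lebesgue {y. ?r \<le> dist x y} (\<lambda>y. b * ?g y)"
          by (intro set_integrable_mult_right)
        moreover have "(LINT y:{y. ?r \<le> dist x y}|lebesgue. b * ?g y) \<le> b * l t"
        proof -
          have "(LINT y:{y. ?r \<le> dist x y}|lebesgue. ?g y) \<le> integral\<^sup>L lebesgue ?g"
            unfolding set_lebesgue_integral_def using gs g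
            by (intro integral_mono) (auto simp: set_integrable_def indicator_def)
          also have "\<dots> = l t" by (simp add: l_def Ls_norm_def p_def)
          finally show ?thesis unfolding set_integral_mult_right using b by (intro mult_left_mono) auto
        qed
        moreover have "u (y, t) / norm (x - y) powr p \<le> b * ?g y" if y: "?r \<le> dist x y" for y
        proof -
          have d: "0 < dist x y" using z y by linarith
          have "1 \<le> (4 * dist x y) powr p" using z y p by (intro ge_one_powr_ge_zero) auto
          moreover have "norm y powr p \<le> (6 * dist x y) powr p"
            using norm_le_dist_outside[OF x y] p by (intro powr_mono2) auto
          ultimately have "1 + norm y powr p \<le> b * dist x y powr p"
            using d by (simp add: b_def powr_mult distrib_right)
          moreover have "0 < 1 + norm y powr p" by (smt (verit) powr_ge_zero)
          ultimately have "1 / dist x y powr p \<le> b / (1 + norm y powr p)"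
            using d by (simp add: field_simps)
          then have "\<bar>u (y, t)\<bar> * (1 / dist x y powr p) \<le> \<bar>u (y, t)\<bar> * (b / (1 + norm y powr p))"
            by (intro mult_left_mono) auto
          moreover have "u (y, t) / dist x y powr p \<le> \<bar>u (y, t)\<bar> / dist x y powr p"
            by (intro divide_right_mono) auto
          ultimately show ?thesis by (simp add: dist_norm mult.commute)
        qed
        ultimately show "\<exists>G. set_integrable lebesgue {y. ?r \<le> dist x y} G \<and>
            (LINT y:{y. ?r \<le> dist x y}|lebesgue. G y) \<le> b * l t \<and>
            (\<forall>y. ?r \<le> dist x y \<longrightarrow> u (y, t) / norm (x - y) powr p \<le> G y)"
          by blast
      qed
    next
      have contA: "continuous_on {0..T} A"
        unfolding A_def by (intro continuous_intros indefinite_integral_continuous_1 l_int)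
      have growA: "\<forall>\<^sub>F \<tau> in at_left t. (t - \<tau>) * (b * l t - \<eta>) \<le> A t - A \<tau>"
        if t: "t \<in> {0<..T}" and \<eta>: "0 < \<eta>" for t \<eta>
      proof -
        have "continuous_on (S_cyl T) u"
          by (rule continuous_on_subset[OF cont]) (auto simp: S_cyl_def S_bar_def)
        then have "\<forall>\<^sub>F \<tau> in at t within {0<..T}. l t - \<eta> / b < l \<tau>"
          unfolding l_def using Ls t \<eta> b by (intro Ls_norm_lower_semicontinuous) auto
        then obtain d where d: "0 < d"
            "\<And>\<tau>. \<lbrakk>\<tau> \<in> {0<..T}; \<tau> \<noteq> t; dist \<tau> t < d\<rbrakk> \<Longrightarrow> l t - \<eta> / b < l \<tau>"
          unfolding eventually_at by blast
        have step: "(t - \<tau>) * (b * l t - \<eta>) \<le> A t - A \<tau>" if \<tau>: "max 0 (t - d) < \<tau>" "\<tau> < t" for \<tau>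
        proof -
          have "integral {\<tau>..t} (\<lambda>_. l t - \<eta> / b) \<le> integral {\<tau>..t} l"
          proof (rule integral_le)
            show "l integrable_on {\<tau>..t}" using \<tau> t by (intro l_sub) auto
            fix x assume x: "x \<in> {\<tau>..t}"
            show "l t - \<eta> / b \<le> l x"
              using d(2)[of x] x \<tau> t \<eta> b by (cases "x = t") (auto simp: dist_real_def)
          qed auto
          then have le: "(t - \<tau>) * (l t - \<eta> / b) \<le> integral {\<tau>..t} l" using \<tau> by simp
          have "integral {0..\<tau>} l + integral {\<tau>..t} l = integral {0..t} l"
            using \<tau> t l_sub by (intro Henstock_Kurzweil_Integration.integral_combine) auto
          then have "A t - A \<tau> = b * integral {\<tau>..t} l"
            by (simp add: A_def flip: right_diff_distrib)
          moreover have "(t - \<tau>) * (b * l t - \<eta>) = b * ((t - \<tau>) * (l t - \<eta> / b))"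
            using b by (simp add: field_simps)
          moreover have "b * ((t - \<tau>) * (l t - \<eta> / b)) \<le> b * integral {\<tau>..t} l"
            using le b by (intro mult_left_mono) auto
          ultimately show ?thesis by linarith
        qed
        show ?thesis
          unfolding eventually_at_left_field using t d step by (intro exI[of _ "max 0 (t - d)"]) auto
      qed
      show "upper_primitive T (\<lambda>t. b * l t) A"
        using contA growA A0 b l0 by (auto simp: upper_primitive_def)
    qed
    also have "\<dots> \<le> k * norm z powr \<alpha> * (norm z powr (\<sigma> - 2 * s) + A T)"
      using k A_mono[OF t] by (intro mult_left_mono add_mono) auto
    also have "\<dots> \<le> k * norm z powr \<alpha> * ((1 + A T) * (norm z powr (\<sigma> - 2 * s) + 1))"
      using k AT by (intro mult_left_mono) (auto simp: algebra_simps)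
    also have "\<dots> = k * (1 + A T) * (norm z powr (\<sigma> - 2 * s + \<alpha>) + norm z powr \<alpha>)"
      by (simp add: powr_add distrib_left distrib_right mult_ac)
    finally show "u (z, t) \<le> k * (1 + A T) * (norm z powr (\<sigma> - 2 * s + \<alpha>) + norm z powr \<alpha>)" .
  qed
qed

section \<open>Uniqueness\<close>

lemma pv_solution_nonpos:
  fixes u :: "(real^'n) \<times> real \<Rightarrow> real"
  assumes s: "0 \<le> s" "s < 1" and T: "0 \<le> T" and K: "0 < K"
    and rho: "\<And>x. K * (1 + (norm x)\<^sup>2) powr (- \<alpha> / 2) \<le> \<rho> x" and rho_pos: "\<And>x. 0 < \<rho> x"
    and sol: "pv_solution c \<rho> s T u" and c: "0 \<le> c"
    and cont: "continuous_on (S_bar T) u" and init: "\<And>x. u (x, 0) = 0"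
    and \<sigma>: "0 \<le> \<sigma>" "\<sigma> < 2 * s - \<alpha>" and C: "0 \<le> C"
    and bd: "\<And>x t. t \<in> {0<..T} \<Longrightarrow> \<bar>u (x, t)\<bar> \<le> C * (1 + (norm x)\<^sup>2) powr (\<sigma> / 2)"
    and Ls: "\<And>t. t \<in> {0<..T} \<Longrightarrow> (\<lambda>x. u (x, t)) \<in> Ls_space s"
    and L1: "set_integrable lebesgue {0<..<T} (\<lambda>t. Ls_norm s (\<lambda>x. u (x, t)))"
    and t: "t \<in> {0..T}"
  shows "u (z, t) \<le> 0"
proof -
  define \<beta> where "\<beta> = \<sigma> - 2 * s + \<alpha>"
  have \<beta>: "\<beta> < 0" using \<sigma> by (simp add: \<beta>_def)
  have vanish: "((\<lambda>x. x powr e) \<longlongrightarrow> 0) at_top" if "e < 0" for e :: real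
    using that by (rule tendsto_neg_powr) (rule filterlim_ident)
  obtain f where f: "(f \<longlongrightarrow> 0) at_top"
      "\<And>z t. \<lbrakk>1 \<le> norm z; t \<in> {0..T}\<rbrakk> \<Longrightarrow> u (z, t) \<le> f (norm z)"
  proof (cases "0 \<le> \<alpha>")
    case True
    then have "\<sigma> < 2 * s" using \<sigma> by simp
    then obtain k where
      "\<And>z t. \<lbrakk>1 \<le> norm z; t \<in> {0..T}\<rbrakk> \<Longrightarrow> u (z, t) \<le> k * norm z powr \<beta>"
      using decay_of_subcritical_growth[OF s(2) T K rho sol c cont init \<sigma>(1) _ C bd]
      unfolding \<beta>_def by metis
    moreover have "((\<lambda>x. k * x powr \<beta>) \<longlongrightarrow> 0) at_top"
      by (rule tendsto_mult_right_zero[OF vanish[OF \<beta>]])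
    ultimately show thesis using that[of "\<lambda>x. k * x powr \<beta>"] by blast
  next
    case False
    obtain k where
      "\<And>z t. \<lbrakk>1 \<le> norm z; t \<in> {0..T}\<rbrakk> \<Longrightarrow> u (z, t) \<le> k * (norm z powr \<beta> + norm z powr \<alpha>)"
      using decay_of_integrable_solution[OF s T K rho sol c cont init \<sigma>(1) C bd Ls L1]
      unfolding \<beta>_def by metis
    moreover have "((\<lambda>x. k * (x powr \<beta> + x powr \<alpha>)) \<longlongrightarrow> 0) at_top"
      using vanish[OF \<beta>] vanish[of \<alpha>] False by (intro tendsto_mult_right_zero tendsto_add_zero) auto
    ultimately show thesis using that[of "\<lambda>x. k * (x powr \<beta> + x powr \<alpha>)"] by blast
  qed
  show ?thesis
  proof (rule maximum_principle_decaying[OF sol c rho_pos cont init _ t])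
    fix e :: real assume "0 < e"
    then have "\<forall>\<^sub>F x in at_top. f x < e" using f(1) by (simp add: order_tendstoD)
    then obtain R where R: "\<And>x. R \<le> x \<Longrightarrow> f x < e" by (auto simp: eventually_at_top_linorder)
    have "u (x, \<tau>) \<le> e" if "max 1 R \<le> norm x" "\<tau> \<in> {0..T}" for x \<tau>
      using f(2)[of x \<tau>] R[of "norm x"] that by fastforce
    then show "\<exists>R. \<forall>x t. R \<le> norm x \<longrightarrow> t \<in> {0..T} \<longrightarrow> u (x, t) \<le> e" by blast
  qed
qed

theorem corollary2p6:
  fixes s T K \<alpha> \<sigma> C :: real
    and \<rho> :: "real^'n \<Rightarrow> real"
    and u :: "(real^'n) \<times> real \<Rightarrow> real"
  assumes "0 < s" and "s < 1" and "0 < T"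
    and "continuous_on UNIV \<rho>" and "\<And>x. 0 < \<rho> x"
    and "0 < K" and "\<alpha> < 2 * s"
    and "\<And>x. K * (1 + (norm x)\<^sup>2) powr (- \<alpha> / 2) \<le> \<rho> x"
    and "zero_problem_solution \<rho> s T u"
    and "0 < \<sigma>" and "\<sigma> < 2 * s - \<alpha>" and "0 < C"
    and "\<And>x t. (x, t) \<in> S_cyl T \<Longrightarrow> \<bar>u (x, t)\<bar> \<le> C * (1 + (norm x)\<^sup>2) powr (\<sigma> / 2)"
  shows "\<forall>(x, t)\<in>S_cyl T. u (x, t) = 0"
proof (clarsimp simp: S_cyl_def)
  fix x t assume t: "0 < t" "t \<le> T"
  have zp: "continuous_on (S_bar T) u" "\<And>x. u (x, 0) = 0" "equation_solution \<rho> s T u"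
      "set_integrable lebesgue {0<..<T} (\<lambda>t. Ls_norm s (\<lambda>x. u (x, t)))"
    using assms(9) unfolding zero_problem_solution_def L1_time_Ls_def by blast+
  have Ls: "(\<lambda>x. u (x, t)) \<in> Ls_space s" if "t \<in> {0<..T}" for t
    using zp(3) that unfolding equation_solution_def by blast
  have bd: "\<bar>u (x, t)\<bar> \<le> C * (1 + (norm x)\<^sup>2) powr (\<sigma> / 2)" if "t \<in> {0<..T}" for x t
    using assms(13) that by (auto simp: S_cyl_def)
  note sol = equation_solution_imp_pv_solution[OF zp(3)]
  have tT: "t \<in> {0..T}" using t by simp
  have "u (x, t) \<le> 0"
    by (rule pv_solution_nonpos[OF _ assms(2) _ assms(6,8,5) sol frac_const_nonneg zp(1,2) _ assms(11)
          less_imp_le[OF assms(12)] bd Ls zp(4) tT])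
      (use assms in auto)
  moreover have "- u (x, t) \<le> 0"
  proof (rule pv_solution_nonpos[OF _ assms(2) _ assms(6,8,5) pv_solution_uminus[OF sol] frac_const_nonneg
        _ _ _ assms(11) less_imp_le[OF assms(12)] _ _ _ tT])
    show "continuous_on (S_bar T) (\<lambda>q. - u q)" using zp(1) by (intro continuous_intros)
    show "(\<lambda>x. - u (x, t)) \<in> Ls_space s" if "t \<in> {0<..T}" for t
      using Ls[OF that] by (simp add: Ls_space_def)
    show "set_integrable lebesgue {0<..<T} (\<lambda>t. Ls_norm s (\<lambda>x. - u (x, t)))"
      using zp(4) by (simp add: Ls_norm_def)
  qed (use assms zp bd in auto)
  ultimately show "u (x, t) = 0" by simp
qed

end
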